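(* In the setting below, assume the path $(Z_1,Z_2)$ minimizes the action, $Z_1(0)=0$, $Z_2(0)\neq0$ lies on the positive $x$-axis, $Z_1(1)\in\overline{\mathsf{Q}_1}$ and $Z_2(1)\in\overline{\mathsf{Q}_4}$. If $Z_1(1)\in\mathsf{Q}_1$ or $Z_2(1)\in\mathsf{Q}_4$, then $Z_1(t)\in\overline{\mathsf{Q}_1}$ and $Z_2(t)\in\overline{\mathsf{Q}_4}$ for all $t\in[0,1]$, i.e. $Z_i(t)=\widetilde Z_i(t)$ for all $t\in[0,1]$, $i=1,2$. If both $Z_1(1)$ and $Z_2(1)$ lie on the positive $x$-axis, then either $Z_1(t)\in\overline{\mathsf{Q}_1}$ and $Z_2(t)\in\overline{\mathsf{Q}_4}$ for all $t\in[0,1]$, or $Z_1(t)\in\overline{\mathsf{Q}_4}$ and $Z_2(t)\in\overline{\mathsf{Q}_1}$ for all $t\in[0,1]$.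
   Context: Planar three-body problem with masses $m_1=m_2=m_3=1$, $\chi=\{q=(q_1,q_2,q_3)\in(\mathbb{R}^2)^3: q_1+q_2+q_3=0\}$. Let $Q_{S_4}=\{q: q_1=q_2=(-a_2,0),\ q_3=(2a_2,0),\ a_2\ge0\}$ and $Q_{E_1}=\{q: q_1=(0,-2b_1),\ q_2=(-b_2,b_1),\ q_3=(b_2,b_1),\ b_1,b_2\in\mathbb{R}\}$. The path $q$ minimizes $\mathcal{A}(q)=\int_0^1\big(\tfrac12\sum|\dot q_i|^2+\sum_{i<j}\frac{1}{|q_i-q_j|}\big)dt$ over $\{q\in H^1([0,1],\chi): q(0)\in Q_{S_4},\ q(1)\in Q_{E_1}\}$; it is collision-free for $t\in(0,1]$ and satisfies Newton's equations there. Jacobi coordinates $Z_1=q_1-q_2=(Z_{1x},Z_{1y})$, $Z_2=q_3-\frac{q_1+q_2}{2}=(Z_{2x},Z_{2y})$. $\widetilde Z_1(t)=(|Z_{1x}(t)|,|Z_{1y}(t)|)$, $\widetilde Z_2(t)=(|Z_{2x}(t)|,-|Z_{2y}(t)|)$. $\mathsf{Q}_i$ is the open $i$-th quadrant of the plane (e.g. $\mathsf{Q}_1=\{x>0,y>0\}$) and $\overline{\mathsf{Q}_i}$ its closure. *)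

theory Defs
  imports "HOL-Analysis.Analysis"
begin

type_synonym pt = "real \<times> real"

definition H1_path :: "(real \<Rightarrow> pt) \<Rightarrow> bool" where
  "H1_path f \<longleftrightarrow> (\<exists>g::real \<Rightarrow> pt. g \<in> borel_measurable lborel \<and>
      set_integrable lborel {0..1} g \<and>
      set_nn_integral lborel {0..1} (\<lambda>t. ennreal ((norm (g t))\<^sup>2)) < \<infinity> \<and>
      (\<forall>t\<in>{0..1}. f t = f 0 + (LINT s:{0..t}|lborel. g s)))"

definition inv_dist :: "pt \<Rightarrow> pt \<Rightarrow> ennreal" where
  "inv_dist x y = (if x = y then \<infinity> else ennreal (1 / dist x y))"

text \<open>The action (values in [0,\<infinity>]); derivatives are the a.e. classical derivatives.\<close>
definition action :: "(real \<Rightarrow> pt) \<Rightarrow> (real \<Rightarrow> pt) \<Rightarrow> (real \<Rightarrow> pt) \<Rightarrow> ennreal" where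
  "action q1 q2 q3 = set_nn_integral lborel {0..1} (\<lambda>t.
      ennreal (((norm (vector_derivative q1 (at t)))\<^sup>2 + (norm (vector_derivative q2 (at t)))\<^sup>2
               + (norm (vector_derivative q3 (at t)))\<^sup>2) / 2)
      + inv_dist (q1 t) (q2 t) + inv_dist (q1 t) (q3 t) + inv_dist (q2 t) (q3 t))"

definition in_Q_S4 :: "pt \<Rightarrow> pt \<Rightarrow> pt \<Rightarrow> bool" where
  "in_Q_S4 x1 x2 x3 \<longleftrightarrow> (\<exists>a2::real. a2 \<ge> 0 \<and> x1 = (-a2, 0) \<and> x2 = (-a2, 0) \<and> x3 = (2*a2, 0))"

definition in_Q_E1 :: "pt \<Rightarrow> pt \<Rightarrow> pt \<Rightarrow> bool" where
  "in_Q_E1 x1 x2 x3 \<longleftrightarrow> (\<exists>b1 b2::real. x1 = (0, -2*b1) \<and> x2 = (-b2, b1) \<and> x3 = (b2, b1))"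

definition admissible :: "(real \<Rightarrow> pt) \<Rightarrow> (real \<Rightarrow> pt) \<Rightarrow> (real \<Rightarrow> pt) \<Rightarrow> bool" where
  "admissible q1 q2 q3 \<longleftrightarrow> H1_path q1 \<and> H1_path q2 \<and> H1_path q3 \<and>
     (\<forall>t\<in>{0..1}. q1 t + q2 t + q3 t = 0) \<and>
     in_Q_S4 (q1 0) (q2 0) (q3 0) \<and> in_Q_E1 (q1 1) (q2 1) (q3 1)"

definition minimizer :: "(real \<Rightarrow> pt) \<Rightarrow> (real \<Rightarrow> pt) \<Rightarrow> (real \<Rightarrow> pt) \<Rightarrow> bool" where
  "minimizer q1 q2 q3 \<longleftrightarrow> admissible q1 q2 q3 \<and>
     (\<forall>p1 p2 p3. admissible p1 p2 p3 \<longrightarrow> action q1 q2 q3 \<le> action p1 p2 p3)"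

definition force :: "pt \<Rightarrow> pt \<Rightarrow> pt \<Rightarrow> pt" where
  "force x y z = (1 / (norm (y - x))^3) *\<^sub>R (y - x) + (1 / (norm (z - x))^3) *\<^sub>R (z - x)"

definition newton_on :: "real set \<Rightarrow> (real \<Rightarrow> pt) \<Rightarrow> (real \<Rightarrow> pt) \<Rightarrow> (real \<Rightarrow> pt) \<Rightarrow> bool" where
  "newton_on S q1 q2 q3 \<longleftrightarrow> (\<exists>v1 v2 v3. \<forall>t\<in>S.
      (q1 has_vector_derivative v1 t) (at t) \<and> (q2 has_vector_derivative v2 t) (at t) \<and>
      (q3 has_vector_derivative v3 t) (at t) \<and>
      (v1 has_vector_derivative force (q1 t) (q2 t) (q3 t)) (at t) \<and>
      (v2 has_vector_derivative force (q2 t) (q1 t) (q3 t)) (at t) \<and>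
      (v3 has_vector_derivative force (q3 t) (q1 t) (q2 t)) (at t))"

definition quadrant1 :: "pt set" where "quadrant1 = {p. fst p > 0 \<and> snd p > 0}"
definition quadrant4 :: "pt set" where "quadrant4 = {p. fst p > 0 \<and> snd p < 0}"
definition pos_x_axis :: "pt set" where "pos_x_axis = {p. fst p > 0 \<and> snd p = 0}"

end

theory Submission
  imports Defs
begin

text \<open>
  Write $z = (Z_{1x}, Z_{1y}, Z_{2x}, Z_{2y})$. Reflecting the components into the closed first and
  fourth quadrants keeps the kinetic energy and lowers $|Z_1 \cdot Z_2|$, hence lowers the potential;
  as $z$ is minimal, this forces $Z_{1x} Z_{1y} Z_{2x} Z_{2y} \le 0$ on $(0,1)$. The reflected path is
  again minimal, so it has no corners: cutting off a corner of $|z_i|$ by a short constant piece saves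
  kinetic energy and costs arbitrarily little potential. Hence every zero of a component in $(0,1)$ is
  a double zero. If only one component vanishes there, Newton's equations give it a second derivative
  that violates the sign condition. If two vanish, they solve a linear homogeneous system and vanish
  identically; the boundary conditions then leave only the collinear motion $Z_{1y} = Z_{2y} = 0$. So
  all components have constant sign, and the claim is read off at the end points.
\<close>

section \<open>Weak derivatives\<close>

text \<open>Newton's equations are known for the given minimizer, not for its reflected copy. The
  smoothness of that copy therefore cannot be read off from an Euler-Lagrange equation, and its
  corners are excluded by explicit competitors. The competitors have corners themselves, while
  \<open>action\<close> takes classical derivatives and \<open>H1_path\<close> asks for an integral
  representation. \<open>weak_deriv\<close> carries both, with a countable exceptional set: such a
  set is Lebesgue null and survives finite unions. The binary collision at time 0 makes the
  potential infinite there and leaves the speeds uncontrolled. Pointwise work therefore stays in the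
  open interval, integrability of the speeds is drawn from the finiteness of the minimal action, and
  the end points enter through continuity. Among the six pairs of components, common zeros of Z_1x
  and Z_1y are collisions. The four other pairs besides the y-pair would vanish on the whole
  interval, against the end conditions.\<close>

definition weak_deriv :: "(real \<Rightarrow> real) \<Rightarrow> (real \<Rightarrow> real) \<Rightarrow> bool" where
  "weak_deriv f g \<longleftrightarrow> g \<in> borel_measurable borel \<and>
     (\<forall>t\<in>{0..1}. (g has_integral (f t - f 0)) {0..t}) \<and>
     (\<exists>K. countable K \<and> (\<forall>t\<in>{0<..<1} - K. (f has_real_derivative g t) (at t)))"

text \<open>An isolated point selects a basic open set that meets the set in this point alone, which
  gives an injection into a countable basis.\<close>

lemma countable_isolated_points:
  fixes K :: "'a::second_countable_topology set"
  assumes "\<And>x. x \<in> K \<Longrightarrow> \<exists>T. open T \<and> T \<inter> K = {x}"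
  shows "countable K"
proof -
  obtain B :: "'a set set" where B: "countable B" "topological_basis B"
    using ex_countable_basis by blast
  have "\<exists>U\<in>B. U \<inter> K = {x}" if x: "x \<in> K" for x
  proof -
    obtain T where T: "open T" "T \<inter> K = {x}" using assms x by blast
    then obtain U where "U \<in> B" "x \<in> U" "U \<subseteq> T"
      using topological_basisE[OF B(2), of T x] by blast
    then show ?thesis using T x by (intro bexI[of _ U]) auto
  qed
  then obtain h where h: "\<And>x. x \<in> K \<Longrightarrow> h x \<in> B \<and> h x \<inter> K = {x}" by metis
  have "inj_on h K" by (rule inj_onI) (metis h singleton_inject)
  moreover have "h ` K \<subseteq> B" using h by auto
  ultimately show ?thesis using B(1) by (metis countable_image_inj_on countable_subset)
qed

text \<open>Near a zero with nonzero derivative the difference quotient stays nonzero, so such zeros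
  are isolated. They are the times at which \<open>\<bar>f\<bar>\<close> has a corner.\<close>

lemma countable_transversal_zeros:
  fixes f f' :: "real \<Rightarrow> real"
  assumes "\<And>t. t \<in> S \<Longrightarrow> (f has_real_derivative f' t) (at t)"
  shows "countable {t \<in> S. f t = 0 \<and> f' t \<noteq> 0}"
proof (rule countable_isolated_points)
  fix x assume x: "x \<in> {t \<in> S. f t = 0 \<and> f' t \<noteq> 0}"
  let ?K = "{t \<in> S. f t = 0 \<and> f' t \<noteq> 0}"
  have "((\<lambda>y. (f y - f x) / (y - x)) \<longlongrightarrow> f' x) (at x)"
    using assms[of x] x unfolding has_field_derivative_iff by blast
  then have "\<forall>\<^sub>F y in at x. (f y - f x) / (y - x) \<noteq> 0"
    using x by (intro tendsto_imp_eventually_ne) auto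
  then obtain T where T: "open T" "x \<in> T" "\<And>y. y \<in> T \<Longrightarrow> y \<noteq> x \<Longrightarrow> (f y - f x) / (y - x) \<noteq> 0"
    unfolding eventually_at_topological by blast
  have "T \<inter> ?K = {x}" using T x by fastforce
  then show "\<exists>T. open T \<and> T \<inter> ?K = {x}" using T(1) by blast
qed

text \<open>At a double zero the difference quotients of \<open>\<bar>f\<bar>\<close> and of
  \<open>f\<close> agree in absolute value and tend to 0, in accordance with
  \<open>sgn 0 = 0\<close>. Away from zeros the sign is locally constant.\<close>

lemma has_real_derivative_abs:
  assumes f: "(f has_real_derivative D) (at (t::real))" and "f t \<noteq> 0 \<or> D = 0"
  shows "((\<lambda>s. \<bar>f s\<bar>) has_real_derivative sgn (f t) * D) (at t)"
proof (cases "f t = 0")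
  case True
  then have D: "D = 0" using assms by auto
  have "((\<lambda>y. (f y - f t) / (y - t)) \<longlongrightarrow> 0) (at t)"
    using f D by (auto simp: has_field_derivative_iff)
  then have "((\<lambda>y. \<bar>(f y - f t) / (y - t)\<bar>) \<longlongrightarrow> 0) (at t)"
    using tendsto_rabs_zero by blast
  then have "((\<lambda>y. (\<bar>f y\<bar> - \<bar>f t\<bar>) / (y - t)) \<longlongrightarrow> 0) (at t)"
    by (rule Lim_null_comparison[rotated]) (simp add: True)
  then show ?thesis using D by (simp add: has_field_derivative_iff)
next
  case False
  have c: "isCont f t" using f DERIV_isCont by blast
  show ?thesis
  proof (cases "f t > 0")
    case True
    have "\<forall>\<^sub>F s in nhds t. 0 < f s"
      using order_tendstoD(1)[OF isContD[OF c] True] True by (simp add: eventually_nhds_conv_at)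
    then have "\<forall>\<^sub>F s in nhds t. \<bar>f s\<bar> = f s" by eventually_elim simp
    then show ?thesis using f True DERIV_cong_ev[of t t "\<lambda>s. \<bar>f s\<bar>" f D D] by simp
  next
    case neg: False
    then have n: "f t < 0" using False by simp
    have "\<forall>\<^sub>F s in nhds t. f s < 0"
      using order_tendstoD(2)[OF isContD[OF c] n] n by (simp add: eventually_nhds_conv_at)
    then have "\<forall>\<^sub>F s in nhds t. \<bar>f s\<bar> = - f s" by eventually_elim simp
    then show ?thesis using DERIV_minus[OF f] n
        DERIV_cong_ev[of t t "\<lambda>s. \<bar>f s\<bar>" "\<lambda>s. - f s" "-D" "-D"] by simp
  qed
qed

text \<open>The smooth approximations $\sqrt{f^2 + \varepsilon^2}$ have derivatives dominated by $|f'|$.\<close>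
lemma weak_deriv_abs:
  assumes cont: "continuous_on {0..1} f"
    and der: "\<And>t. t \<in> {0<..<1} \<Longrightarrow> (f has_real_derivative g t) (at t)"
    and meas: "g \<in> borel_measurable borel"
    and int: "g absolutely_integrable_on {0..1}"
  shows "weak_deriv (\<lambda>t. \<bar>f t\<bar>) (\<lambda>t. indicator {0<..<1} t * (sgn (f t) * g t))"
    (is "weak_deriv _ ?g")
proof -
  have sgn_eq: "sgn x = (if 0 < x then 1 else if x < 0 then -1 else 0)" for x :: real by auto
  have fm: "(\<lambda>t. indicator {0<..<1} t * f t) \<in> borel_measurable borel"
  proof -
    have "continuous_on {0<..<1} f" by (rule continuous_on_subset[OF cont]) auto
    then show ?thesis using borel_measurable_continuous_on_indicator[of "{0<..<1}" f] by simp
  qed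
  have "?g = (\<lambda>t. sgn (indicator {0<..<1} t * f t) * g t)"
    by (auto simp: fun_eq_iff indicator_def)
  then have m: "?g \<in> borel_measurable borel" using fm meas unfolding sgn_eq by auto
  have sub: "g absolutely_integrable_on {0..t}" if "t \<in> {0..1}" for t
    using absolutely_integrable_on_subinterval[OF int, of 0 t] that by auto
  have hi: "(?g has_integral (\<bar>f t\<bar> - \<bar>f 0\<bar>)) {0..t}" if t: "t \<in> {0..1}" for t
  proof -
    define e where "e k = 1 / real (Suc k)" for k :: nat
    define h where "h k s = sqrt ((f s)\<^sup>2 + (e k)\<^sup>2)" for k s
    define h' where "h' k s = f s * g s / h k s" for k s
    have e: "e k > 0" for k by (simp add: e_def)
    have hpos: "h k s > 0" for k s
      unfolding h_def using e[of k] by (simp add: add_nonneg_pos)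
    have hf: "\<bar>f s\<bar> \<le> h k s" for k s
      unfolding h_def by (rule real_le_rsqrt) simp
    have ct: "continuous_on {0..t} f" using continuous_on_subset[OF cont] t by auto
    have i: "(h' k has_integral (h k t - h k 0)) {0..t}" for k
    proof (rule fundamental_theorem_of_calculus_interior)
      show "0 \<le> t" using t by auto
      show "continuous_on {0..t} (h k)" unfolding h_def by (intro continuous_intros ct)
      fix s assume "s \<in> {0<..<t}"
      then have d: "(f has_real_derivative g s) (at s)" using der t by auto
      have "(h k has_real_derivative h' k s) (at s)"
        unfolding h_def h'_def using hpos[of k s] e[of k]
        by (auto intro!: derivative_eq_intros d simp: h_def field_simps add_nonneg_pos)
      then show "(h k has_vector_derivative h' k s) (at s)"
        by (simp add: has_real_derivative_iff_has_vector_derivative)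
    qed
    have e0: "e \<longlonglongrightarrow> 0" unfolding e_def using LIMSEQ_inverse_real_of_nat by (simp add: inverse_eq_divide)
    have hlim: "(\<lambda>k. h k s) \<longlonglongrightarrow> \<bar>f s\<bar>" for s
    proof -
      have "(\<lambda>k. sqrt ((f s)\<^sup>2 + (e k)\<^sup>2)) \<longlonglongrightarrow> sqrt ((f s)\<^sup>2 + 0\<^sup>2)" by (intro tendsto_intros e0)
      then show ?thesis by (simp add: h_def)
    qed
    have h'lim: "(\<lambda>k. h' k s) \<longlonglongrightarrow> sgn (f s) * g s" for s
    proof (cases "f s = 0")
      case False
      then have "(\<lambda>k. h' k s) \<longlonglongrightarrow> f s * g s / \<bar>f s\<bar>"
        unfolding h'_def by (intro tendsto_intros hlim) auto
      moreover have "f s * g s / \<bar>f s\<bar> = sgn (f s) * g s" using False by (simp add: sgn_if)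
      ultimately show ?thesis by simp
    qed (simp add: h'_def)
    have bd: "norm (h' k s) \<le> \<bar>g s\<bar>" for k s
    proof -
      have "\<bar>f s * g s\<bar> \<le> \<bar>g s\<bar> * h k s" using mult_right_mono[OF hf[of s k], of "\<bar>g s\<bar>"] by (simp add: abs_mult mult.commute)
      then show ?thesis using hpos[of k s] by (simp add: h'_def abs_divide divide_le_eq)
    qed
    have gi: "(\<lambda>s. \<bar>g s\<bar>) integrable_on {0..t}"
      using sub[OF t] by (simp add: absolutely_integrable_on_def)
    note dc = dominated_convergence[of h' "{0..t}" "\<lambda>s. \<bar>g s\<bar>" "\<lambda>s. sgn (f s) * g s"]
    have 1: "(\<lambda>s. sgn (f s) * g s) integrable_on {0..t}"
      and 2: "(\<lambda>k. integral {0..t} (h' k)) \<longlonglongrightarrow> integral {0..t} (\<lambda>s. sgn (f s) * g s)"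
      using dc i gi bd h'lim by blast+
    have "(\<lambda>k. h k t - h k 0) \<longlonglongrightarrow> \<bar>f t\<bar> - \<bar>f 0\<bar>" by (intro tendsto_intros hlim)
    moreover have "integral {0..t} (h' k) = h k t - h k 0" for k using i by blast
    ultimately have "integral {0..t} (\<lambda>s. sgn (f s) * g s) = \<bar>f t\<bar> - \<bar>f 0\<bar>"
      using 2 LIMSEQ_unique by auto
    then have "((\<lambda>s. sgn (f s) * g s) has_integral (\<bar>f t\<bar> - \<bar>f 0\<bar>)) {0..t}"
      using 1 by (metis integrable_integral)
    then show ?thesis
      by (rule has_integral_spike_finite[of "{0,1}", rotated 2]) (use t in \<open>auto simp: indicator_def\<close>)
  qed
  have d: "((\<lambda>t. \<bar>f t\<bar>) has_real_derivative ?g t) (at t)"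
    if "t \<in> {0<..<1} - {t \<in> {0<..<1}. f t = 0 \<and> g t \<noteq> 0}" for t
    using has_real_derivative_abs[OF der, of t] that by auto
  have c: "countable {t \<in> {0<..<1}. f t = 0 \<and> g t \<noteq> 0}"
    by (rule countable_transversal_zeros[OF der])
  show ?thesis
    unfolding weak_deriv_def
  proof (intro conjI ballI exI)
    show "countable {t \<in> {0<..<1}. f t = 0 \<and> g t \<noteq> 0}" by (rule c)
  qed (use m hi d in blast)+
qed

lemma weak_deriv_lincomb:
  assumes "weak_deriv f f'" "weak_deriv g g'"
  shows "weak_deriv (\<lambda>t. a * f t + b * g t) (\<lambda>t. a * f' t + b * g' t)"
proof -
  obtain K L where K: "countable K" "\<forall>t\<in>{0<..<1} - K. (f has_real_derivative f' t) (at t)"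
    and L: "countable L" "\<forall>t\<in>{0<..<1} - L. (g has_real_derivative g' t) (at t)"
    using assms unfolding weak_deriv_def by blast
  have "\<forall>t\<in>{0<..<1} - (K \<union> L). ((\<lambda>t. a * f t + b * g t) has_real_derivative a * f' t + b * g' t) (at t)"
    using K L by (auto intro!: derivative_eq_intros)
  moreover have "((\<lambda>t. a * f' t + b * g' t) has_integral (a * f t + b * g t - (a * f 0 + b * g 0))) {0..t}"
    if "t \<in> {0..1}" for t
  proof -
    have "((\<lambda>t. a * f' t + b * g' t) has_integral (a * (f t - f 0) + b * (g t - g 0))) {0..t}"
      using assms that unfolding weak_deriv_def by (intro has_integral_add has_integral_mult_right) auto
    then show ?thesis by (simp add: algebra_simps)
  qed
  moreover have "(\<lambda>t. a * f' t + b * g' t) \<in> borel_measurable borel"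
    using assms unfolding weak_deriv_def by (intro borel_measurable_add borel_measurable_times) auto
  moreover have "countable (K \<union> L)" using K(1) L(1) by simp
  ultimately show ?thesis unfolding weak_deriv_def by blast
qed

text \<open>The plateau has the height that \<open>f\<close> takes at both of its ends, so no jump
  arises and the integral of the new derivative can be added up over the three pieces. The two new
  corners join the exceptional set.\<close>

lemma weak_deriv_flatten:
  assumes w: "weak_deriv f g" and ab: "0 \<le> a" "a < b" "b \<le> 1" and fa: "f a = c" and fb: "f b = c"
  shows "weak_deriv (\<lambda>t. if t \<in> {a..b} then c else f t) (\<lambda>t. if t \<in> {a..b} then 0 else g t)"
    (is "weak_deriv ?F ?G")
proof -
  have gi: "(g has_integral (f t - f 0)) {0..t}" if "t \<in> {0..1}" for t
    using w that unfolding weak_deriv_def by blast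
  have gi2: "(g has_integral (f t - f s)) {s..t}" if "0 \<le> s" "s \<le> t" "t \<le> 1" for s t
  proof -
    have "g integrable_on {s..t}"
      using integrable_on_subinterval[of g "{0..1}" s t] gi[of 1] that by (auto simp: integrable_on_def)
    then obtain J where J: "(g has_integral J) {s..t}" by blast
    have "(g has_integral (f s - f 0 + J)) {0..t}"
      by (rule has_integral_combine[OF _ _ gi J]) (use that in auto)
    then have "f s - f 0 + J = f t - f 0"
      using gi[of t] that by (intro has_integral_unique) auto
    then have "J = f t - f s" by simp
    then show ?thesis using J by simp
  qed
  have F0: "?F 0 = f 0" using ab fa by auto
  have left: "(?G has_integral (f t - f 0)) {0..t}" if "0 \<le> t" "t \<le> a" for t
    by (rule has_integral_spike_finite[OF _ _ gi[of t], of "{a}"]) (use that ab in auto)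
  have mid: "(?G has_integral 0) {a..t}" if "a \<le> t" "t \<le> b" for t
    by (rule has_integral_is_0) (use that in auto)
  have right: "(?G has_integral (f t - f b)) {b..t}" if "b \<le> t" "t \<le> 1" for t
    by (rule has_integral_spike_finite[OF _ _ gi2[of b t], of "{b}"]) (use that ab in auto)
  have lm: "(?G has_integral (c - f 0)) {0..t}" if "a \<le> t" "t \<le> b" for t
    using has_integral_combine[OF ab(1) that(1) left mid] that ab fa by auto
  have hi: "(?G has_integral (?F t - ?F 0)) {0..t}" if t: "t \<in> {0..1}" for t
  proof -
    consider "t < a" | "t \<in> {a..b}" | "b < t" by force
    then show ?thesis
    proof cases
      case 1
      then show ?thesis using left[of t] t F0 by auto
    next
      case 2
      then show ?thesis using lm[of t] F0 by auto
    next
      case 3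
      have "(?G has_integral (c - f 0 + (f t - f b))) {0..t}"
        by (rule has_integral_combine[OF _ _ lm[of b] right]) (use 3 ab t in auto)
      then show ?thesis using 3 F0 fb by auto
    qed
  qed
  obtain K where K: "countable K" "\<forall>t\<in>{0<..<1} - K. (f has_real_derivative g t) (at t)"
    using w unfolding weak_deriv_def by blast
  have d: "(?F has_real_derivative ?G t) (at t)" if t: "t \<in> {0<..<1} - (K \<union> {a,b})" for t
  proof (cases "t \<in> {a..b}")
    case True
    then have tb: "t \<in> {a<..<b}" using t by auto
    then have ev: "\<forall>\<^sub>F s in nhds t. s \<in> {a<..<b}" by (intro eventually_nhds_in_open) auto
    then have "\<forall>\<^sub>F s in nhds t. ?F s = c" by eventually_elim auto
    then show ?thesis using DERIV_cong_ev[of t t ?F "\<lambda>_. c" 0 0] True by simp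
  next
    case False
    have "\<forall>\<^sub>F s in nhds t. s \<in> - {a..b}" using False by (intro eventually_nhds_in_open) (auto intro: open_Compl)
    then have "\<forall>\<^sub>F s in nhds t. ?F s = f s" by eventually_elim auto
    moreover have "?G t = g t" using False by auto
    ultimately show ?thesis using DERIV_cong_ev[of t t ?F f "g t" "g t"] K t by simp
  qed
  have "?G \<in> borel_measurable borel"
    using w unfolding weak_deriv_def by (auto intro!: measurable_If_set)
  moreover have "countable (K \<union> {a,b})" using K(1) by simp
  ultimately show ?thesis unfolding weak_deriv_def using hi d by blast
qed

section \<open>The action in Jacobi coordinates\<close>

text \<open>A configuration is given by the four components
  $(u_0, u_1) = Z_1$ and $(u_2, u_3) = Z_2$ of its Jacobi coordinates.\<close>
definition sq12 :: "(nat \<Rightarrow> real) \<Rightarrow> real" where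
  "sq12 u = (u 0)\<^sup>2 + (u 1)\<^sup>2"

definition sq13 :: "(nat \<Rightarrow> real) \<Rightarrow> real" where
  "sq13 u = (u 2 - u 0 / 2)\<^sup>2 + (u 3 - u 1 / 2)\<^sup>2"

definition sq23 :: "(nat \<Rightarrow> real) \<Rightarrow> real" where
  "sq23 u = (u 2 + u 0 / 2)\<^sup>2 + (u 3 + u 1 / 2)\<^sup>2"

definition collision_free :: "(nat \<Rightarrow> real) \<Rightarrow> bool" where
  "collision_free u \<longleftrightarrow> 0 < sq12 u \<and> 0 < sq13 u \<and> 0 < sq23 u"

definition potential :: "(nat \<Rightarrow> real) \<Rightarrow> real" where
  "potential u = 1 / sqrt (sq12 u) + 1 / sqrt (sq13 u) + 1 / sqrt (sq23 u)"

text \<open>The weights 1/4 and 1/3 are half the reduced masses 1/2 and 2/3 of the Jacobi vectors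
  for three unit masses.\<close>

definition kinetic :: "(nat \<Rightarrow> real) \<Rightarrow> real" where
  "kinetic e = ((e 0)\<^sup>2 + (e 1)\<^sup>2) / 4 + ((e 2)\<^sup>2 + (e 3)\<^sup>2) / 3"

definition lagrangian :: "(nat \<Rightarrow> real) \<Rightarrow> (nat \<Rightarrow> real) \<Rightarrow> real" where
  "lagrangian u e = kinetic e + potential u"

text \<open>The three body maps invert the Jacobi coordinates when the centre of mass is at the
  origin. Every coordinate, even with coefficient 0, has the shape \<open>a * x + b * y\<close> that
  \<open>weak_deriv_lincomb\<close> produces. Being linear, the maps serve velocities as well as
  positions.\<close>

definition body1 :: "(nat \<Rightarrow> real) \<Rightarrow> pt" where
  "body1 u = (1/2 * u 0 + (- 1/3) * u 2, 1/2 * u 1 + (- 1/3) * u 3)"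

definition body2 :: "(nat \<Rightarrow> real) \<Rightarrow> pt" where
  "body2 u = ((- 1/2) * u 0 + (- 1/3) * u 2, (- 1/2) * u 1 + (- 1/3) * u 3)"

definition body3 :: "(nat \<Rightarrow> real) \<Rightarrow> pt" where
  "body3 u = (0 * u 0 + 2/3 * u 2, 0 * u 1 + 2/3 * u 3)"

lemma sq_nonneg [simp]: "0 \<le> sq12 u" "0 \<le> sq13 u" "0 \<le> sq23 u"
  by (auto simp: sq12_def sq13_def sq23_def)

lemma kinetic_nonneg: "0 \<le> kinetic e"
  by (simp add: kinetic_def)

lemma potential_nonneg: "0 \<le> potential u"
  by (simp add: potential_def)

lemma lagrangian_nonneg: "0 \<le> lagrangian u e"
  by (simp add: lagrangian_def kinetic_nonneg potential_nonneg)

lemma dist_bodies: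
  "dist (body1 u) (body2 u) = sqrt (sq12 u)"
  "dist (body1 u) (body3 u) = sqrt (sq13 u)"
  "dist (body2 u) (body3 u) = sqrt (sq23 u)"
  unfolding body1_def body2_def body3_def sq12_def sq13_def sq23_def dist_Pair_Pair dist_real_def
    power2_abs
  by (rule arg_cong[where f=sqrt], simp only: power2_eq_square, simp add: field_simps)+

lemma collision_free_iff:
  "collision_free u \<longleftrightarrow> body1 u \<noteq> body2 u \<and> body1 u \<noteq> body3 u \<and> body2 u \<noteq> body3 u"
proof -
  have "0 < sq12 u \<longleftrightarrow> 0 < dist (body1 u) (body2 u)" "0 < sq13 u \<longleftrightarrow> 0 < dist (body1 u) (body3 u)"
    "0 < sq23 u \<longleftrightarrow> 0 < dist (body2 u) (body3 u)"
    unfolding dist_bodies by simp_all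
  then show ?thesis unfolding collision_free_def by simp
qed

lemma kinetic_eq: "((norm (body1 e))\<^sup>2 + (norm (body2 e))\<^sup>2 + (norm (body3 e))\<^sup>2) / 2 = kinetic e"
proof -
  have "(norm (x, y))\<^sup>2 = x\<^sup>2 + y\<^sup>2" for x y :: real by (simp add: norm_Pair)
  then show ?thesis
    unfolding body1_def body2_def body3_def kinetic_def
    by (simp only: power2_eq_square) (simp add: field_simps)
qed

lemma potential_eq:
  assumes "collision_free u"
  shows "inv_dist (body1 u) (body2 u) + inv_dist (body1 u) (body3 u) + inv_dist (body2 u) (body3 u)
    = ennreal (potential u)"
  using assms unfolding collision_free_iff inv_dist_def potential_def
  by (simp add: dist_bodies ennreal_plus[symmetric] del: ennreal_plus)

lemma action_eq:
  assumes K: "countable K"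
    and der: "\<And>t. t \<in> {0<..<1} - K \<Longrightarrow> (p1 has_vector_derivative body1 (d t)) (at t) \<and>
      (p2 has_vector_derivative body2 (d t)) (at t) \<and> (p3 has_vector_derivative body3 (d t)) (at t)"
    and pos: "\<And>t. t \<in> {0<..<1} \<Longrightarrow> p1 t = body1 (u t) \<and> p2 t = body2 (u t) \<and> p3 t = body3 (u t)"
    and cf: "\<And>t. t \<in> {0<..<1} \<Longrightarrow> collision_free (u t)"
  shows "action p1 p2 p3 = (\<integral>\<^sup>+t\<in>{0<..<1}. ennreal (lagrangian (u t) (d t)) \<partial>lborel)"
proof -
  have "AE t in lborel. t \<notin> K \<union> {0,1}"
    by (rule AE_not_in) (use K in \<open>auto intro!: countable_imp_null_set_lborel\<close>)
  then have "AE t in lborel. (ennreal (((norm (vector_derivative p1 (at t)))\<^sup>2 + (norm (vector_derivative p2 (at t)))\<^sup>2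
               + (norm (vector_derivative p3 (at t)))\<^sup>2) / 2)
      + inv_dist (p1 t) (p2 t) + inv_dist (p1 t) (p3 t) + inv_dist (p2 t) (p3 t)) * indicator {0..1} t
      = ennreal (lagrangian (u t) (d t)) * indicator {0<..<1} t"
  proof eventually_elim
    case (elim t)
    show ?case
    proof (cases "t \<in> {0<..<1}")
      case True
      then have "t \<in> {0<..<1} - K" using elim by auto
      note D = der[OF this]
      have "vector_derivative p1 (at t) = body1 (d t)" "vector_derivative p2 (at t) = body2 (d t)"
        "vector_derivative p3 (at t) = body3 (d t)"
        using D by (auto intro: vector_derivative_at)
      then show ?thesis
        using True pos[OF True] potential_eq[OF cf[OF True]] kinetic_eq[of "d t"]
        by (simp only:) (simp add: lagrangian_def kinetic_nonneg potential_nonneg add.assoc)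
    qed (use elim in auto)
  qed
  then show ?thesis unfolding action_def by (rule nn_integral_cong_AE)
qed

section \<open>Admissible paths from components, and comparison of actions\<close>

lemma weak_deriv_continuous_on:
  assumes "weak_deriv f g"
  shows "continuous_on {0..1} f"
proof -
  have gi: "(g has_integral (f t - f 0)) {0..t}" if "t \<in> {0..1}" for t
    using assms that unfolding weak_deriv_def by blast
  have "g integrable_on {0..1}" using gi[of 1] by auto
  then have c: "continuous_on {0..1} (\<lambda>t. f 0 + integral {0..t} g)"
    by (intro continuous_intros indefinite_integral_continuous_1)
  have e: "f 0 + integral {0..t} g = f t" if "t \<in> {0..1}" for t
    using integral_unique[OF gi[OF that]] by simp
  show ?thesis by (rule continuous_on_eq[OF c e])
qed

text \<open>The bound \<open>norm x \<le> 1 + (norm x)^2\<close> suffices because the unit interval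
  has finite measure.\<close>

lemma set_integrable_of_square:
  fixes g :: "real \<Rightarrow> 'b::euclidean_space"
  assumes m: "g \<in> borel_measurable borel"
    and fin: "(\<integral>\<^sup>+t\<in>{0..1}. ennreal ((norm (g t))\<^sup>2) \<partial>lborel) < \<infinity>"
  shows "set_integrable lborel {0..1} g"
  unfolding set_integrable_def
proof (rule integrableI_bounded)
  show "(\<lambda>x. indicat_real {0..1} x *\<^sub>R g x) \<in> borel_measurable lborel" using m by simp
  have "(\<integral>\<^sup>+ x. ennreal (norm (indicat_real {0..1} x *\<^sub>R g x)) \<partial>lborel) \<le>
    (\<integral>\<^sup>+ x. indicator {0..1} x + ennreal ((norm (g x))\<^sup>2) * indicator {0..1} x \<partial>lborel)"
  proof (rule nn_integral_mono)
    fix x :: real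
    have "norm (g x) \<le> 1 + (norm (g x))\<^sup>2"
      using sum_squares_bound[of 1 "norm (g x)"] norm_ge_zero[of "g x"] by (simp del: norm_ge_zero)
    then have "ennreal (norm (g x)) \<le> 1 + ennreal ((norm (g x))\<^sup>2)"
      by (metis ennreal_1 ennreal_leI ennreal_plus zero_le_one zero_le_power2)
    then show "ennreal (norm (indicat_real {0..1} x *\<^sub>R g x)) \<le> indicator {0..1} x + ennreal ((norm (g x))\<^sup>2) * indicator {0..1} x"
      by (simp add: indicator_def)
  qed
  also have "\<dots> = (\<integral>\<^sup>+ x. indicator {0..1::real} x \<partial>lborel) + (\<integral>\<^sup>+t\<in>{0..1}. ennreal ((norm (g t))\<^sup>2) \<partial>lborel)"
    using m by (intro nn_integral_add) auto
  also have "\<dots> < \<infinity>" using fin by (simp add: nn_integral_indicator)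
  finally show "(\<integral>\<^sup>+ x. ennreal (norm (indicat_real {0..1} x *\<^sub>R g x)) \<partial>lborel) < \<infinity>" .
qed

text \<open>\<open>weak_deriv\<close> provides gauge integrals of real functions,
  \<open>H1_path\<close> asks for the Lebesgue integral of a plane vector. Finite energy makes the
  pair Lebesgue integrable; the two integrals then agree and commute with the projections.\<close>

lemma H1_pathI:
  assumes a: "weak_deriv a a'" and b: "weak_deriv b b'"
    and fin: "(\<integral>\<^sup>+t\<in>{0..1}. ennreal ((norm (a' t, b' t))\<^sup>2) \<partial>lborel) < \<infinity>"
  shows "H1_path (\<lambda>t. (a t, b t))"
proof -
  let ?g = "\<lambda>t. (a' t, b' t)"
  have m: "?g \<in> borel_measurable borel"
    using a b unfolding weak_deriv_def by (intro borel_measurable_Pair) auto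
  have si: "set_integrable lborel {0..1} ?g" by (rule set_integrable_of_square[OF m fin])
  have "(a t, b t) = (a 0, b 0) + (LINT s:{0..t}|lborel. ?g s)" if t: "t \<in> {0..1}" for t
  proof -
    have "set_integrable lborel {0..t} ?g"
      by (rule set_integrable_subset[OF si]) (use t in auto)
    note I = set_borel_integral_eq_integral[OF this]
    have "integral {0..t} (fst \<circ> ?g) = fst (integral {0..t} ?g)"
      "integral {0..t} (snd \<circ> ?g) = snd (integral {0..t} ?g)"
      using integral_linear[OF I(1)] bounded_linear_fst bounded_linear_snd by blast+
    moreover have "integral {0..t} a' = a t - a 0" "integral {0..t} b' = b t - b 0"
      using a b t unfolding weak_deriv_def by (auto intro!: integral_unique)
    ultimately have "integral {0..t} ?g = (a t - a 0, b t - b 0)"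
      by (simp add: o_def prod_eq_iff)
    then show ?thesis using I(2) by simp
  qed
  then have "\<forall>t\<in>{0..1}. (a t, b t) = (a 0, b 0) + (LINT s:{0..t}|lborel. ?g s)" by blast
  moreover have "?g \<in> borel_measurable lborel" using m by simp
  ultimately show ?thesis unfolding H1_path_def using si fin by blast
qed

lemma lagrangian_measurable:
  assumes w: "\<And>i. i < 4 \<Longrightarrow> weak_deriv (\<lambda>t. u t i) (\<lambda>t. d t i)"
  shows "(\<lambda>t. ennreal (lagrangian (u t) (d t)) * indicator {0<..<1} t) \<in> borel_measurable borel"
proof -
  \<comment> \<open>Positions are known to be continuous on the closed unit interval only. The
    cut-off makes them Borel measurable on the whole line, and the indicator factor hides the
    change.\<close>
  define v where "v t i = indicator {0<..<1} t * u t i" for t i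
  have v: "(\<lambda>t. v t i) \<in> borel_measurable borel" if "i < 4" for i
  proof -
    have "continuous_on {0<..<1} (\<lambda>t. u t i)"
      by (rule continuous_on_subset[OF weak_deriv_continuous_on[OF w[OF that]]]) auto
    then show ?thesis
      using borel_measurable_continuous_on_indicator[of "{0<..<1}" "\<lambda>t. u t i"] by (simp add: v_def)
  qed
  have d: "(\<lambda>t. d t i) \<in> borel_measurable borel" if "i < 4" for i
    using w[OF that] unfolding weak_deriv_def by blast
  have [measurable]: "(\<lambda>t. v t 0) \<in> borel_measurable borel" "(\<lambda>t. v t 1) \<in> borel_measurable borel"
    "(\<lambda>t. v t 2) \<in> borel_measurable borel" "(\<lambda>t. v t 3) \<in> borel_measurable borel"
    "(\<lambda>t. d t 0) \<in> borel_measurable borel" "(\<lambda>t. d t 1) \<in> borel_measurable borel"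
    "(\<lambda>t. d t 2) \<in> borel_measurable borel" "(\<lambda>t. d t 3) \<in> borel_measurable borel"
    by (rule v d; simp)+
  have "(\<lambda>t. ennreal (lagrangian (v t) (d t)) * indicator {0<..<1} t) \<in> borel_measurable borel"
    unfolding lagrangian_def kinetic_def potential_def sq12_def sq13_def sq23_def by measurable
  moreover have "ennreal (lagrangian (v t) (d t)) * indicator {0<..<1} t
      = ennreal (lagrangian (u t) (d t)) * indicator {0<..<1} t" for t
  proof (cases "t \<in> {0<..<1}")
    case True
    then have "v t = u t" by (auto simp: v_def fun_eq_iff)
    then show ?thesis by simp
  qed simp
  ultimately show ?thesis by simp
qed

text \<open>The end conditions are \<open>in_Q_S4\<close> and \<open>in_Q_E1\<close> in Jacobi
  coordinates. If the right-hand side is infinite there is nothing to show; if it is finite, it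
  bounds the kinetic energy and so puts the competitor into H1.\<close>

lemma minimizer_action_le:
  assumes min: "minimizer q1 q2 q3"
    and w: "\<And>i. i < 4 \<Longrightarrow> weak_deriv (\<lambda>t. u t i) (\<lambda>t. d t i)"
    and cf: "\<And>t. t \<in> {0<..<1} \<Longrightarrow> collision_free (u t)"
    and start: "u 0 0 = 0" "u 0 1 = 0" "u 0 2 \<ge> 0" "u 0 3 = 0"
    and finish: "u 1 2 = 3/2 * u 1 0" "u 1 3 = - u 1 1 / 2"
  shows "action q1 q2 q3 \<le> (\<integral>\<^sup>+t\<in>{0<..<1}. ennreal (lagrangian (u t) (d t)) \<partial>lborel)"
    (is "_ \<le> ?R")
proof (cases "?R = \<infinity>")
  case False
  then have fin: "?R < \<infinity>" by (simp add: less_top)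
  let ?p1 = "\<lambda>t. body1 (u t)" and ?p2 = "\<lambda>t. body2 (u t)" and ?p3 = "\<lambda>t. body3 (u t)"
  have w0: "weak_deriv (\<lambda>t. u t 0) (\<lambda>t. d t 0)" and w1: "weak_deriv (\<lambda>t. u t 1) (\<lambda>t. d t 1)"
    and w2: "weak_deriv (\<lambda>t. u t 2) (\<lambda>t. d t 2)" and w3: "weak_deriv (\<lambda>t. u t 3) (\<lambda>t. d t 3)"
    using w[of 0] w[of 1] w[of 2] w[of 3] by auto
  have sq: "(\<integral>\<^sup>+t\<in>{0..1}. ennreal (f (d t)) \<partial>lborel) < \<infinity>"
    if f: "\<And>e. f e \<le> 2 * kinetic e" for f :: "(nat \<Rightarrow> real) \<Rightarrow> real"
  proof -
    have "AE t in lborel. t \<notin> {0,1::real}"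
      by (rule AE_not_in) (auto intro!: countable_imp_null_set_lborel)
    then have "AE t in lborel. ennreal (f (d t)) * indicator {0..1} t
      \<le> ennreal 2 * (ennreal (lagrangian (u t) (d t)) * indicator {0<..<1} t)"
    proof eventually_elim
      case (elim t)
      have "f (d t) \<le> 2 * lagrangian (u t) (d t)"
        using f[of "d t"] potential_nonneg[of "u t"] by (simp add: lagrangian_def)
      then have "ennreal (f (d t)) \<le> ennreal 2 * ennreal (lagrangian (u t) (d t))"
        by (metis ennreal_leI ennreal_mult lagrangian_nonneg zero_le_numeral)
      then show ?case using elim by (auto simp: indicator_def)
    qed
    then have "(\<integral>\<^sup>+t\<in>{0..1}. ennreal (f (d t)) \<partial>lborel)
        \<le> (\<integral>\<^sup>+t. ennreal 2 * (ennreal (lagrangian (u t) (d t)) * indicator {0<..<1} t) \<partial>lborel)"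
      by (rule nn_integral_mono_AE)
    also have "\<dots> = ennreal 2 * ?R"
      using lagrangian_measurable[of u d, OF w] by (intro nn_integral_cmult) simp
    also have "\<dots> < \<infinity>" using fin by (simp add: ennreal_mult_less_top)
    finally show ?thesis .
  qed
  have le: "(norm (body1 e))\<^sup>2 \<le> 2 * kinetic e" "(norm (body2 e))\<^sup>2 \<le> 2 * kinetic e"
    "(norm (body3 e))\<^sup>2 \<le> 2 * kinetic e" for e
    unfolding kinetic_eq[symmetric] by simp_all
  have h1: "H1_path ?p1"
    unfolding body1_def
    by (rule H1_pathI[OF weak_deriv_lincomb[OF w0 w2] weak_deriv_lincomb[OF w1 w3]])
       (use sq[OF le(1)] in \<open>simp add: body1_def\<close>)
  have h2: "H1_path ?p2"
    unfolding body2_def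
    by (rule H1_pathI[OF weak_deriv_lincomb[OF w0 w2] weak_deriv_lincomb[OF w1 w3]])
       (use sq[OF le(2)] in \<open>simp add: body2_def\<close>)
  have h3: "H1_path ?p3"
    unfolding body3_def
    by (rule H1_pathI[OF weak_deriv_lincomb[OF w0 w2] weak_deriv_lincomb[OF w1 w3]])
       (use sq[OF le(3)] in \<open>simp add: body3_def\<close>)
  \<comment> \<open>In \<open>in_Q_S4\<close> the second Jacobi vector is (3 a2, 0), whence
    a2.\<close>
  have s4: "in_Q_S4 (?p1 0) (?p2 0) (?p3 0)"
    unfolding in_Q_S4_def body1_def body2_def body3_def using start
    by (intro exI[of _ "u 0 2 / 3"]) auto
  \<comment> \<open>In \<open>in_Q_E1\<close> the first Jacobi vector is (b2, -3 b1), whence b1 and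
    b2.\<close>
  have e1: "in_Q_E1 (?p1 1) (?p2 1) (?p3 1)"
    unfolding in_Q_E1_def body1_def body2_def body3_def using finish
    by (intro exI[of _ "- u 1 1 / 3"] exI[of _ "u 1 0"]) auto
  have "admissible ?p1 ?p2 ?p3"
    unfolding admissible_def using h1 h2 h3 s4 e1
    by (auto simp: body1_def body2_def body3_def prod_eq_iff)
  then have "action q1 q2 q3 \<le> action ?p1 ?p2 ?p3" using min unfolding minimizer_def by blast
  also have "\<dots> = ?R"
  proof -
    have "\<forall>i. \<exists>L. i < 4 \<longrightarrow> countable L \<and> (\<forall>t\<in>{0<..<1} - L. ((\<lambda>t. u t i) has_real_derivative d t i) (at t))"
      using w unfolding weak_deriv_def by blast
    from choice[OF this] obtain K where K0: "\<forall>i. i < 4 \<longrightarrow> countable (K i) \<and>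
      (\<forall>t\<in>{0<..<1} - K i. ((\<lambda>t. u t i) has_real_derivative d t i) (at t))" ..
    have K: "countable (K i)" "t \<in> {0<..<1} - K i \<Longrightarrow> ((\<lambda>t. u t i) has_real_derivative d t i) (at t)"
      if "i < 4" for i t
      using K0 that by simp_all
    show ?thesis
    proof (rule action_eq[where K="\<Union>i<4. K i"])
      show "countable (\<Union>i<4. K i)" using K(1) by auto
      fix t :: real
      assume t: "t \<in> {0<..<1} - (\<Union>i<4. K i)"
      have D: "((\<lambda>t. u t i) has_vector_derivative d t i) (at t)" if "i < 4" for i
        using K(2)[OF that, of t] t that by (auto simp: has_real_derivative_iff_has_vector_derivative)
      have L: "((\<lambda>t. r * u t i + s * u t j) has_vector_derivative r * d t i + s * d t j) (at t)"
        if "i < 4" "j < 4" for i j r s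
        using D[OF that(1)] D[OF that(2)] by (intro has_vector_derivative_add has_vector_derivative_mult_right) auto
      show "(?p1 has_vector_derivative body1 (d t)) (at t) \<and>
        (?p2 has_vector_derivative body2 (d t)) (at t) \<and> (?p3 has_vector_derivative body3 (d t)) (at t)"
        unfolding body1_def body2_def body3_def by (intro conjI has_vector_derivative_Pair L) simp_all
    qed (use cf in auto)
  qed
  finally show ?thesis .
qed simp

lemma weak_deriv_const: "weak_deriv (\<lambda>_. c) (\<lambda>_. 0)"
  unfolding weak_deriv_def by auto

lemma weak_deriv_powr: "weak_deriv (\<lambda>t. t powr (2/3)) (\<lambda>t. 2/3 * t powr (-1/3))"
proof -
  have "((\<lambda>t. 2/3 * t powr (-1/3)) has_integral (t powr (2/3) - 0 powr (2/3))) {0..t}"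
    if "t \<in> {0..1::real}" for t
    using has_integral_mult_right[OF has_integral_powr_from_0[of "-1/3" t], of "2/3"] that by simp
  moreover have "((\<lambda>t. t powr (2/3)) has_real_derivative 2/3 * t powr (-1/3)) (at t)"
    if "t \<in> {0<..<1}" for t :: real
    using that by (auto intro!: derivative_eq_intros)
  ultimately show ?thesis unfolding weak_deriv_def by (intro conjI exI[of _ "{}"]) auto
qed

text \<open>The exponent 2/3 is that of a binary collision: both the squared speed and the
  potential are then of order $t^{-2/3}$.\<close>
lemma minimizer_action_finite:
  assumes min: "minimizer q1 q2 q3"
  shows "action q1 q2 q3 < \<infinity>"
proof -
  \<comment> \<open>A collinear competitor: bodies 1 and 2 separate from their collision along the
    x-axis, and Z_2 rests at (3/2, 0), the value that belongs to Z_1(1) = (1, 0).\<close>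
  define u :: "real \<Rightarrow> nat \<Rightarrow> real" where
    "u t i = (if i = 0 then t powr (2/3) else if i = 2 then 3/2 else 0)" for t i
  define d :: "real \<Rightarrow> nat \<Rightarrow> real" where
    "d t i = (if i = 0 then 2/3 * t powr (-1/3) else 0)" for t i
  \<comment> \<open>The close pair contributes \<open>t powr (-2/3)\<close>, the kinetic energy 1/9
    of that, and each of the other two pairs at most 1, since their distances are at least
    1.\<close>
  let ?F = "\<lambda>t::real. 2 * t powr (-2/3) + 2"
  have w: "weak_deriv (\<lambda>t. u t i) (\<lambda>t. d t i)" for i
    unfolding u_def d_def using weak_deriv_powr weak_deriv_const
    by (cases "i = 0") (simp_all only: if_True if_False, auto)
  have cf: "collision_free (u t) \<and> lagrangian (u t) (d t) \<le> ?F t" if t: "t \<in> {0<..<1}" for t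
  proof -
    define s where "s = t powr (2/3)"
    have s: "0 < s" "s < 1" using t powr_less_mono2[of "2/3" t 1] by (auto simp: s_def)
    have sq: "sq12 (u t) = s\<^sup>2" "sq13 (u t) = (3/2 - s/2)\<^sup>2" "sq23 (u t) = (3/2 + s/2)\<^sup>2"
      by (auto simp: sq12_def sq13_def sq23_def u_def s_def)
    have k: "kinetic (d t) = 1/9 * t powr (-2/3)"
      by (simp add: kinetic_def d_def power2_eq_square powr_add[symmetric])
    have "potential (u t) = 1 / s + 1 / (3/2 - s/2) + 1 / (3/2 + s/2)"
      unfolding potential_def sq using s by simp
    moreover have "1 / s = t powr (-2/3)" by (simp add: powr_minus_divide s_def)
    moreover have "1 / (3/2 - s/2) \<le> 1" "1 / (3/2 + s/2) \<le> 1"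
      using s by (auto simp: divide_le_eq)
    ultimately have "potential (u t) \<le> t powr (-2/3) + 2" by linarith
    moreover have "collision_free (u t)" unfolding collision_free_def sq using s by auto
    ultimately show ?thesis
      using k powr_ge_zero[of t "-2/3"] unfolding lagrangian_def by linarith
  qed
  have "action q1 q2 q3 \<le> (\<integral>\<^sup>+t\<in>{0<..<1}. ennreal (lagrangian (u t) (d t)) \<partial>lborel)"
  proof (rule minimizer_action_le[OF min w])
    show "collision_free (u t)" if "t \<in> {0<..<1}" for t using cf that by blast
  qed (simp_all add: u_def)
  also have "\<dots> \<le> (\<integral>\<^sup>+t. ennreal (indicator {0..1} t * ?F t) \<partial>lborel)"
  proof (rule nn_integral_mono)
    fix t
    show "ennreal (lagrangian (u t) (d t)) * indicator {0<..<1} t \<le> ennreal (indicator {0..1} t * ?F t)"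
    proof (cases "t \<in> {0<..<1}")
      case True
      then have "ennreal (lagrangian (u t) (d t)) \<le> ennreal (?F t)" using cf by (intro ennreal_leI) blast
      then show ?thesis using True by (simp only: indicator_simps) (simp add: indicator_def)
    qed simp
  qed
  also have "\<dots> = ennreal (integral {0..1} ?F)"
  proof (rule nn_integral_has_integral_lborel)
    have "(\<lambda>t::real. t powr (-2/3)) integrable_on {0..1}"
      by (rule integrable_on_powr_from_0) auto
    then have "?F integrable_on {0..1}"
      by (intro integrable_add integrable_on_mult_right integrable_const_ivl) simp
    then have "(?F has_integral integral {0..1} ?F) {0..1}" by (rule integrable_integral)
    then have "((\<lambda>t. if t \<in> {0..1} then ?F t else 0) has_integral integral {0..1} ?F) UNIV"
      by (simp only: has_integral_restrict_UNIV)
    moreover have "(\<lambda>t. if t \<in> {0..1} then ?F t else 0) = (\<lambda>t. indicator {0..1} t * ?F t)"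
      by (auto simp: indicator_def fun_eq_iff)
    ultimately show "((\<lambda>t. indicator {0..1} t * ?F t) has_integral integral {0..1} ?F) UNIV" by simp
  qed (auto simp: indicator_def)
  finally show ?thesis by (simp add: le_less_trans)
qed

text \<open>A pointwise gain of \<epsilon> on an interval lowers the action by at least
  \<open>\<epsilon> * (b - a)\<close>. This contradicts minimality because the minimal action is
  finite and can be cancelled.\<close>

lemma no_better_path:
  assumes min: "minimizer q1 q2 q3"
    and act: "action q1 q2 q3 = (\<integral>\<^sup>+t\<in>{0<..<1}. ennreal (lagrangian (z t) (v t)) \<partial>lborel)"
    and w: "\<And>i. i < 4 \<Longrightarrow> weak_deriv (\<lambda>t. u t i) (\<lambda>t. d t i)"
    and cf: "\<And>t. t \<in> {0<..<1} \<Longrightarrow> collision_free (u t)"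
    and start: "u 0 0 = 0" "u 0 1 = 0" "u 0 2 \<ge> 0" "u 0 3 = 0"
    and finish: "u 1 2 = 3/2 * u 1 0" "u 1 3 = - u 1 1 / 2"
    and le: "\<And>t. t \<in> {0<..<1} \<Longrightarrow> lagrangian (u t) (d t) \<le> lagrangian (z t) (v t)"
    and ab: "0 \<le> a" "a < b" "b \<le> 1" and eps: "0 < \<epsilon>"
    and gap: "\<And>t. t \<in> {a<..<b} \<Longrightarrow> lagrangian (u t) (d t) + \<epsilon> \<le> lagrangian (z t) (v t)"
  shows False
proof -
  let ?A = "action q1 q2 q3"
  let ?f = "\<lambda>t. ennreal (lagrangian (u t) (d t)) * indicator {0<..<1} t"
  have m: "?f \<in> borel_measurable borel" by (rule lagrangian_measurable) (rule w)
  have "?A + ennreal \<epsilon> * ennreal (b - a) \<le> integral\<^sup>N lborel ?f + ennreal \<epsilon> * ennreal (b - a)"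
    using minimizer_action_le[of q1 q2 q3 u d, OF min w cf start finish] by (intro add_right_mono) auto
  also have "\<dots> = integral\<^sup>N lborel ?f + (\<integral>\<^sup>+t. ennreal \<epsilon> * indicator {a<..<b} t \<partial>lborel)"
    using ab by (simp add: nn_integral_cmult_indicator)
  also have "\<dots> = (\<integral>\<^sup>+t. ?f t + ennreal \<epsilon> * indicator {a<..<b} t \<partial>lborel)"
    using m by (intro nn_integral_add[symmetric]) auto
  also have "\<dots> \<le> ?A"
    unfolding act
  proof (rule nn_integral_mono)
    fix t
    show "?f t + ennreal \<epsilon> * indicator {a<..<b} t
      \<le> ennreal (lagrangian (z t) (v t)) * indicator {0<..<1} t"
    proof (cases "t \<in> {a<..<b}")
      case True
      then have "t \<in> {0<..<1}" using ab by auto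
      moreover have "ennreal (lagrangian (u t) (d t)) + ennreal \<epsilon> \<le> ennreal (lagrangian (z t) (v t))"
        using gap[OF True] eps lagrangian_nonneg[of "u t" "d t"]
        by (simp add: ennreal_plus[symmetric] ennreal_leI del: ennreal_plus)
      ultimately show ?thesis using True by simp
    next
      case False
      then show ?thesis using le[of t] by (auto simp: indicator_def intro: ennreal_leI)
    qed
  qed
  finally have "?A + ennreal \<epsilon> * ennreal (b - a) \<le> ?A" .
  moreover have "?A < \<infinity>" by (rule minimizer_action_finite[OF min])
  moreover have "ennreal \<epsilon> * ennreal (b - a) > 0" using eps ab by (simp add: ennreal_zero_less_mult_iff)
  ultimately show False
    by (metis add.right_neutral ennreal_add_left_cancel_le infinity_ennreal_def not_less order_less_irrefl zero_le)
qed

text \<open>Squaring turns the sum into a function of x^2, from which monotonicity in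
  \<open>\<bar>x\<bar>\<close> can be read off.\<close>

lemma inverse_sqrt_pair:
  fixes A x :: real
  assumes "\<bar>x\<bar> < A"
  shows "(1 / sqrt (A - x) + 1 / sqrt (A + x))\<^sup>2 = 2 * A / (A\<^sup>2 - x\<^sup>2) + 2 / sqrt (A\<^sup>2 - x\<^sup>2)"
proof -
  have p: "A - x > 0" "A + x > 0" using assms by auto
  have f: "A\<^sup>2 - x\<^sup>2 = (A - x) * (A + x)" by (simp add: power2_eq_square algebra_simps)
  have "(1 / sqrt (A - x) + 1 / sqrt (A + x))\<^sup>2
      = 1 / (A - x) + 1 / (A + x) + 2 / (sqrt (A - x) * sqrt (A + x))"
    using p by (simp add: power2_sum power_divide)
  also have "1 / (A - x) + 1 / (A + x) = 2 * A / ((A - x) * (A + x))" using p by (simp add: field_simps)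
  finally show ?thesis unfolding f by (simp add: real_sqrt_mult)
qed

text \<open>Both terms of the squared sum decrease as A^2 - x^2 grows, that is, as
  \<open>\<bar>x\<bar>\<close> shrinks with A fixed.\<close>

lemma inverse_sqrt_pair_mono:
  fixes A x y :: real
  assumes xA: "\<bar>x\<bar> < A" and yx: "\<bar>y\<bar> \<le> \<bar>x\<bar>"
  shows "1 / sqrt (A - y) + 1 / sqrt (A + y) \<le> 1 / sqrt (A - x) + 1 / sqrt (A + x)"
    and "\<bar>y\<bar> < \<bar>x\<bar> \<Longrightarrow> 1 / sqrt (A - y) + 1 / sqrt (A + y) < 1 / sqrt (A - x) + 1 / sqrt (A + x)"
proof -
  let ?g = "\<lambda>x. 1 / sqrt (A - x) + 1 / sqrt (A + x)"
  have yA: "\<bar>y\<bar> < A" using assms by linarith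
  have A: "A > 0" using xA by linarith
  have nn: "?g x \<ge> 0" using xA by (intro add_nonneg_nonneg) auto
  have px: "A\<^sup>2 - x\<^sup>2 > 0" using power_strict_mono[of "\<bar>x\<bar>" A 2] xA by simp
  have le: "A\<^sup>2 - x\<^sup>2 \<le> A\<^sup>2 - y\<^sup>2" using yx by (simp add: abs_le_square_iff)
  have "(?g y)\<^sup>2 \<le> (?g x)\<^sup>2"
    unfolding inverse_sqrt_pair[OF xA] inverse_sqrt_pair[OF yA]
    by (intro add_mono divide_left_mono mult_pos_pos) (use px le A in auto)
  then show "?g y \<le> ?g x" using nn by (rule power2_le_imp_le)
  show "?g y < ?g x" if "\<bar>y\<bar> < \<bar>x\<bar>"
  proof -
    have lt: "A\<^sup>2 - x\<^sup>2 < A\<^sup>2 - y\<^sup>2" using that by (meson abs_le_square_iff diff_strict_left_mono linorder_not_le)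
    have "(?g y)\<^sup>2 < (?g x)\<^sup>2"
      unfolding inverse_sqrt_pair[OF xA] inverse_sqrt_pair[OF yA]
      by (intro add_less_le_mono divide_strict_left_mono divide_left_mono mult_pos_pos) (use px lt A in auto)
    then show ?thesis using nn by (rule power2_less_imp_less)
  qed
qed

section \<open>Reflection into the quadrants\<close>

text \<open>Index 3 is Z_2y, the only component that is sent to the nonpositive side.\<close>

definition fold_sign :: "nat \<Rightarrow> real" where
  "fold_sign i = (if i = 3 then - 1 else 1)"

text \<open>This is $(\widetilde Z_1, \widetilde Z_2)$.\<close>
definition quadrant_fold :: "(nat \<Rightarrow> real) \<Rightarrow> nat \<Rightarrow> real" where
  "quadrant_fold u i = fold_sign i * \<bar>u i\<bar>"

text \<open>Since q_3 - q_1 = Z_2 - Z_1/2 and q_3 - q_2 = Z_2 + Z_1/2, changing signs of components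
  can affect these distances only through Z_1 . Z_2.\<close>

lemma sq13_eq: "sq13 u = ((u 2)\<^sup>2 + (u 3)\<^sup>2 + sq12 u / 4) - (u 0 * u 2 + u 1 * u 3)"
  and sq23_eq: "sq23 u = ((u 2)\<^sup>2 + (u 3)\<^sup>2 + sq12 u / 4) + (u 0 * u 2 + u 1 * u 3)"
  by (auto simp: sq12_def sq13_def sq23_def power2_eq_square field_simps)

text \<open>With a = Z_1x Z_2x and b = Z_1y Z_2y, folding replaces the inner product a + b by
  \<open>\<bar>a\<bar> - \<bar>b\<bar>\<close>, which is no larger in absolute value and strictly
  smaller exactly when a b > 0. All else in the three distances is kept.\<close>

lemma fold_potential:
  assumes cf: "collision_free u"
  shows fold_collision_free: "collision_free (quadrant_fold u)"
    and potential_fold_le: "potential (quadrant_fold u) \<le> potential u"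
    and potential_fold_less: "u 0 * u 1 * u 2 * u 3 > 0 \<Longrightarrow> potential (quadrant_fold u) < potential u"
proof -
  define A where "A = (u 2)\<^sup>2 + (u 3)\<^sup>2 + sq12 u / 4"
  define x where "x = u 0 * u 2 + u 1 * u 3"
  define y where "y = \<bar>u 0 * u 2\<bar> - \<bar>u 1 * u 3\<bar>"
  have s: "sq12 (quadrant_fold u) = sq12 u" by (simp add: sq12_def quadrant_fold_def fold_sign_def)
  have e: "sq13 u = A - x" "sq23 u = A + x" "sq13 (quadrant_fold u) = A - y" "sq23 (quadrant_fold u) = A + y"
    unfolding sq13_eq sq23_eq s unfolding quadrant_fold_def fold_sign_def A_def x_def y_def
    by (auto simp: abs_mult)
  have xA: "\<bar>x\<bar> < A" using cf unfolding collision_free_def e by linarith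
  have yx: "\<bar>y\<bar> \<le> \<bar>x\<bar>" unfolding x_def y_def by linarith
  show "collision_free (quadrant_fold u)" using cf xA yx unfolding collision_free_def e s by linarith
  show "potential (quadrant_fold u) \<le> potential u"
    unfolding potential_def e s using inverse_sqrt_pair_mono(1)[OF xA yx] by simp
  show "potential (quadrant_fold u) < potential u" if "u 0 * u 1 * u 2 * u 3 > 0"
  proof -
    have "(u 0 * u 2) * (u 1 * u 3) > 0" using that by (simp add: mult_ac)
    then have "0 < u 0 * u 2 \<and> 0 < u 1 * u 3 \<or> u 0 * u 2 < 0 \<and> u 1 * u 3 < 0"
      by (simp only: zero_less_mult_iff[of "u 0 * u 2"])
    then have "\<bar>y\<bar> < \<bar>x\<bar>" unfolding x_def y_def by linarith
    then show ?thesis unfolding potential_def e s using inverse_sqrt_pair_mono(2)[OF xA yx] by simp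
  qed
qed

text \<open>The filter is left arbitrary because limits are taken both in time and jointly in time
  and the height of a plateau.\<close>

lemma potential_tendsto:
  assumes lim: "\<And>i. i < 4 \<Longrightarrow> ((\<lambda>x. U x i) \<longlongrightarrow> L i) F" and cf: "collision_free L"
  shows "((\<lambda>x. potential (U x)) \<longlongrightarrow> potential L) F"
    and "\<forall>\<^sub>F x in F. collision_free (U x)"
proof -
  have l: "((\<lambda>x. U x 0) \<longlongrightarrow> L 0) F" "((\<lambda>x. U x 1) \<longlongrightarrow> L 1) F"
    "((\<lambda>x. U x 2) \<longlongrightarrow> L 2) F" "((\<lambda>x. U x 3) \<longlongrightarrow> L 3) F"
    by (rule lim; simp)+
  have sq: "((\<lambda>x. sq12 (U x)) \<longlongrightarrow> sq12 L) F" "((\<lambda>x. sq13 (U x)) \<longlongrightarrow> sq13 L) F"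
    "((\<lambda>x. sq23 (U x)) \<longlongrightarrow> sq23 L) F"
    unfolding sq12_def sq13_def sq23_def by (intro tendsto_intros l; simp)+
  show "((\<lambda>x. potential (U x)) \<longlongrightarrow> potential L) F"
    unfolding potential_def
    by (intro tendsto_intros sq) (use cf in \<open>auto simp: collision_free_def\<close>)
  show "\<forall>\<^sub>F x in F. collision_free (U x)"
    unfolding collision_free_def
    by (intro eventually_conj order_tendstoD(1)[OF sq(1)] order_tendstoD(1)[OF sq(2)]
      order_tendstoD(1)[OF sq(3)]) (use cf in \<open>auto simp: collision_free_def\<close>)
qed

section \<open>Ordinary differential equations\<close>

text \<open>Gronwall's argument for E = f^2 + g^2 + f'^2 + g'^2: from
  \<open>\<bar>E'\<bar> \<le> C * E\<close> and E(t0) = 0, an exponential factor makes the product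
  monotone and forces E to vanish, on either side of t0.\<close>

lemma linear_ode_pair_zero:
  fixes f g f' g' a b c d :: "real \<Rightarrow> real"
  assumes f: "\<And>t. t \<in> {lo<..<hi} \<Longrightarrow> (f has_real_derivative f' t) (at t)"
    and g: "\<And>t. t \<in> {lo<..<hi} \<Longrightarrow> (g has_real_derivative g' t) (at t)"
    and f': "\<And>t. t \<in> {lo<..<hi} \<Longrightarrow> (f' has_real_derivative a t * f t + b t * g t) (at t)"
    and g': "\<And>t. t \<in> {lo<..<hi} \<Longrightarrow> (g' has_real_derivative c t * f t + d t * g t) (at t)"
    and cont: "continuous_on {lo<..<hi} a" "continuous_on {lo<..<hi} b"
      "continuous_on {lo<..<hi} c" "continuous_on {lo<..<hi} d"
    and t0: "t0 \<in> {lo<..<hi}" and init: "f t0 = 0" "g t0 = 0" "f' t0 = 0" "g' t0 = 0"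
    and t: "t \<in> {lo<..<hi}"
  shows "f t = 0 \<and> g t = 0"
proof -
  \<comment> \<open>The coefficients may blow up at the ends of the open interval, so they are
    bounded on the compact span of t0 and t only.\<close>
  define l h where "l = min t0 t" and "h = max t0 t"
  have sub: "{l..h} \<subseteq> {lo<..<hi}" using t t0 by (auto simp: l_def h_def)
  have "continuous_on {l..h} (\<lambda>s. \<bar>a s\<bar> + \<bar>b s\<bar> + \<bar>c s\<bar> + \<bar>d s\<bar>)"
    by (intro continuous_intros continuous_on_subset[OF _ sub] cont)
  then have "bounded ((\<lambda>s. \<bar>a s\<bar> + \<bar>b s\<bar> + \<bar>c s\<bar> + \<bar>d s\<bar>) ` {l..h})"
    by (intro compact_imp_bounded compact_continuous_image) auto
  then obtain M where "\<forall>s\<in>{l..h}. \<bar>\<bar>a s\<bar> + \<bar>b s\<bar> + \<bar>c s\<bar> + \<bar>d s\<bar>\<bar> \<le> M"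
    unfolding bounded_iff by auto
  then have M: "\<bar>a s\<bar> \<le> M \<and> \<bar>b s\<bar> \<le> M \<and> \<bar>c s\<bar> \<le> M \<and> \<bar>d s\<bar> \<le> M" if "s \<in> {l..h}" for s
    using that by (smt (verit))
  define E where "E s = (f s)\<^sup>2 + (g s)\<^sup>2 + (f' s)\<^sup>2 + (g' s)\<^sup>2" for s
  define E' where "E' s = 2 * (f s * f' s) + 2 * (g s * g' s) + 2 * (f' s * (a s * f s + b s * g s))
      + 2 * (g' s * (c s * f s + d s * g s))" for s
  \<comment> \<open>In E' the products f f' and g g' contribute at most E each, the four products
    with a coefficient at most M E each.\<close>
  define C where "C = 2 + 4 * M"
  have dE: "(E has_real_derivative E' s) (at s)" if "s \<in> {l..h}" for s
    unfolding E_def E'_def using that sub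
    by (auto intro!: derivative_eq_intros f g f' g' simp: algebra_simps)
  have bd: "\<bar>E' s\<bar> \<le> C * E s" if s: "s \<in> {l..h}" for s
  proof -
    have p: "2 * \<bar>x * y\<bar> \<le> E s" if "x\<^sup>2 + y\<^sup>2 \<le> E s" for x y
      using sum_squares_bound[of "\<bar>x\<bar>" "\<bar>y\<bar>"] that by (simp add: abs_mult)
    have q: "\<bar>2 * (r * (x * y))\<bar> \<le> M * E s" if "\<bar>r\<bar> \<le> M" "x\<^sup>2 + y\<^sup>2 \<le> E s" for r x y
    proof -
      have "\<bar>2 * (r * (x * y))\<bar> = \<bar>r\<bar> * (2 * \<bar>x * y\<bar>)" by (simp add: abs_mult)
      also have "\<dots> \<le> M * E s" by (rule mult_mono) (use that p in auto)
      finally show ?thesis .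
    qed
    note Ms = M[OF s]
    have "E' s = 2 * (f s * f' s) + 2 * (g s * g' s) + 2 * (a s * (f' s * f s)) + 2 * (b s * (f' s * g s))
      + 2 * (c s * (g' s * f s)) + 2 * (d s * (g' s * g s))"
      unfolding E'_def by (simp add: algebra_simps)
    moreover have "2 * \<bar>f s * f' s\<bar> \<le> E s" "2 * \<bar>g s * g' s\<bar> \<le> E s"
      by (rule p; simp add: E_def)+
    moreover have "\<bar>2 * (a s * (f' s * f s))\<bar> \<le> M * E s" "\<bar>2 * (b s * (f' s * g s))\<bar> \<le> M * E s"
      "\<bar>2 * (c s * (g' s * f s))\<bar> \<le> M * E s" "\<bar>2 * (d s * (g' s * g s))\<bar> \<le> M * E s"
      by (rule q; use Ms in \<open>simp add: E_def\<close>)+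
    moreover have "C * E s = 2 * E s + 4 * (M * E s)" by (simp add: C_def algebra_simps)
    ultimately show ?thesis by linarith
  qed
  have E0: "E t0 = 0" using init by (simp add: E_def)
  have "E t \<le> 0"
  proof (cases "t0 \<le> t")
    case True
    have "exp (- C * t) * E t \<le> exp (- C * t0) * E t0"
    proof (rule DERIV_nonpos_imp_nonincreasing[OF True])
      fix s assume "t0 \<le> s" "s \<le> t"
      then have s: "s \<in> {l..h}" by (auto simp: l_def h_def)
      have "((\<lambda>s. exp (- C * s) * E s) has_real_derivative exp (- C * s) * (E' s - C * E s)) (at s)"
        by (auto intro!: derivative_eq_intros dE[OF s] simp: algebra_simps)
      moreover have "exp (- C * s) * (E' s - C * E s) \<le> 0"
        using bd[OF s] by (intro mult_nonneg_nonpos) auto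
      ultimately show "\<exists>y. ((\<lambda>s. exp (- C * s) * E s) has_real_derivative y) (at s) \<and> y \<le> 0" by blast
    qed
    then show ?thesis using E0 by (simp add: mult_le_0_iff)
  next
    case False
    then have le: "t \<le> t0" by simp
    have "exp (C * t) * E t \<le> exp (C * t0) * E t0"
    proof (rule DERIV_nonneg_imp_nondecreasing[OF le])
      fix s assume "t \<le> s" "s \<le> t0"
      then have s: "s \<in> {l..h}" by (auto simp: l_def h_def)
      have "((\<lambda>s. exp (C * s) * E s) has_real_derivative exp (C * s) * (E' s + C * E s)) (at s)"
        by (auto intro!: derivative_eq_intros dE[OF s] simp: algebra_simps)
      moreover have "exp (C * s) * (E' s + C * E s) \<ge> 0"
        using bd[OF s] by (intro mult_nonneg_nonneg) auto
      ultimately show "\<exists>y. ((\<lambda>s. exp (C * s) * E s) has_real_derivative y) (at s) \<and> 0 \<le> y" by blast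
    qed
    then show ?thesis using E0 by (simp add: mult_le_0_iff)
  qed
  then have "(f t)\<^sup>2 \<le> 0" "(g t)\<^sup>2 \<le> 0"
    unfolding E_def by (smt (verit) zero_le_power2)+
  then show ?thesis by simp
qed

text \<open>The second derivative at the single point t0 makes f' positive just to the right of it,
  and the mean value theorem passes this on to f.\<close>

lemma pos_right_of_strict_min:
  fixes f f' :: "real \<Rightarrow> real"
  assumes f: "\<And>t. t \<in> {t0..<hi} \<Longrightarrow> (f has_real_derivative f' t) (at t)"
    and f': "(f' has_real_derivative c) (at t0)" and c: "c > 0"
    and hi: "t0 < hi" and init: "f t0 = 0" "f' t0 = 0"
  shows "\<forall>\<^sub>F t in at_right t0. f t > 0"
proof -
  obtain d where d: "d > 0" "\<And>k. 0 < k \<Longrightarrow> k < d \<Longrightarrow> f' t0 < f' (t0 + k)"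
    using DERIV_pos_inc_right[OF f' c] by blast
  have "f t > 0" if t: "t0 < t" "t < min hi (t0 + d)" for t
  proof -
    obtain \<xi> where x: "t0 < \<xi>" "\<xi> < t" "f t - f t0 = (t - t0) * f' \<xi>"
      using MVT2[OF t(1), of f f'] f t by auto
    have "f' \<xi> > 0" using d(2)[of "\<xi> - t0"] x t init by auto
    then show ?thesis using x t init by simp
  qed
  then show ?thesis
    unfolding eventually_at_right[OF hi] using d(1) hi by (intro exI[of _ "min hi (t0 + d)"]) auto
qed

lemma nonneg_on_closed_interval:
  fixes f :: "real \<Rightarrow> real"
  assumes "continuous_on {0..1} f" "\<And>t. t \<in> {0<..<1} \<Longrightarrow> 0 \<le> f t" "t \<in> {0..1}"
  shows "0 \<le> f t"
  using continuous_ge_on_closure[of "{0<..<1}" f t 0] assms by simp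

lemma nonzero_constant_sign:
  fixes f :: "real \<Rightarrow> real"
  assumes cont: "continuous_on {0..1} f" and nz: "\<And>t. t \<in> {0<..<1} \<Longrightarrow> f t \<noteq> 0"
  shows "(\<forall>t\<in>{0<..<1}. f t > 0) \<or> (\<forall>t\<in>{0<..<1}. f t < 0)"
proof (rule ccontr)
  assume "\<not> ?thesis"
  then obtain s t where st: "s \<in> {0<..<1}" "t \<in> {0<..<1}" "f s < 0" "f t > 0"
    using nz by (metis linorder_neqE_linordered_idom)
  have "continuous_on {0<..<1} f" by (rule continuous_on_subset[OF cont]) auto
  then have "connected (f ` {0<..<1})" by (intro connected_continuous_image) auto
  then have "0 \<in> f ` {0<..<1}"
    using st unfolding connected_iff_interval by (meson imageI less_imp_le)
  then show False using nz by auto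
qed

lemma less_4_cases: "i < 4 \<Longrightarrow> i = 0 \<or> i = 1 \<or> i = 2 \<or> i = (3::nat)"
  by auto

text \<open>The factor 1/4 is the smaller of the two weights 1/4 and 1/3 in \<open>kinetic\<close>,
  so it works for each index.\<close>

lemma kinetic_gap:
  assumes i: "i < 4" and le: "\<And>j. (w j)\<^sup>2 \<le> (x j)\<^sup>2" and w: "w i = 0"
  shows "kinetic w + (x i)\<^sup>2 / 4 \<le> kinetic x"
proof -
  define W X where "W j = (w j)\<^sup>2" and "X j = (x j)\<^sup>2" for j
  have sq: "W 0 \<le> X 0" "W 1 \<le> X 1" "W 2 \<le> X 2" "W 3 \<le> X 3" "0 \<le> X i" "W i = 0"
    unfolding W_def X_def using le w by auto
  have "i = 0 \<or> i = 1 \<or> i = 2 \<or> i = 3" using i by auto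
  then have "(W 0 + W 1) / 4 + (W 2 + W 3) / 3 + X i / 4 \<le> (X 0 + X 1) / 4 + (X 2 + X 3) / 3"
    using sq by (auto simp: add_divide_distrib)
  then show ?thesis by (simp only: kinetic_def W_def X_def)
qed

section \<open>Zeros of a minimizing solution\<close>

text \<open>Newton's equations enter in a form that exposes their algebra: \<alpha> and \<sigma> are
  arbitrary continuous functions, and \<kappa>, the strength with which Z_1 . Z_2 couples the two
  Jacobi vectors, is positive. Its sign is what clashes with the sign condition at an isolated
  zero.\<close>

locale minimizing_solution =
  fixes q1 q2 q3 :: "real \<Rightarrow> pt" and z v :: "real \<Rightarrow> nat \<Rightarrow> real" and \<alpha> \<sigma> \<kappa> :: "real \<Rightarrow> real"
  assumes min: "minimizer q1 q2 q3"
    and action_lagrangian: "action q1 q2 q3 = (\<integral>\<^sup>+t\<in>{0<..<1}. ennreal (lagrangian (z t) (v t)) \<partial>lborel)"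
    and cont_z: "\<And>i. i < 4 \<Longrightarrow> continuous_on {0..1} (\<lambda>t. z t i)"
    and deriv_z: "\<And>i t. i < 4 \<Longrightarrow> t \<in> {0<..<1} \<Longrightarrow> ((\<lambda>t. z t i) has_real_derivative v t i) (at t)"
    and cf: "\<And>t. t \<in> {0<..1} \<Longrightarrow> collision_free (z t)"
    and start: "z 0 0 = 0" "z 0 1 = 0" "z 0 2 > 0" "z 0 3 = 0"
    and finish: "z 1 2 = 3/2 * z 1 0" "z 1 3 = - z 1 1 / 2" "z 1 0 \<ge> 0" "z 1 1 \<ge> 0"
    and coeff: "continuous_on {0<..<1} \<alpha>" "continuous_on {0<..<1} \<sigma>" "continuous_on {0<..<1} \<kappa>"
    and kappa_pos: "\<And>t. t \<in> {0<..<1} \<Longrightarrow> \<kappa> t > 0"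
    and deriv_v:
      "\<And>t. t \<in> {0<..<1} \<Longrightarrow> ((\<lambda>t. v t 0) has_real_derivative
        \<kappa> t * (z t 0 * z t 2 + z t 1 * z t 3) * z t 2 - \<alpha> t * z t 0) (at t)"
      "\<And>t. t \<in> {0<..<1} \<Longrightarrow> ((\<lambda>t. v t 1) has_real_derivative
        \<kappa> t * (z t 0 * z t 2 + z t 1 * z t 3) * z t 3 - \<alpha> t * z t 1) (at t)"
      "\<And>t. t \<in> {0<..<1} \<Longrightarrow> ((\<lambda>t. v t 2) has_real_derivative
        3/4 * \<kappa> t * (z t 0 * z t 2 + z t 1 * z t 3) * z t 0 - \<sigma> t * z t 2) (at t)"
      "\<And>t. t \<in> {0<..<1} \<Longrightarrow> ((\<lambda>t. v t 3) has_real_derivative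
        3/4 * \<kappa> t * (z t 0 * z t 2 + z t 1 * z t 3) * z t 1 - \<sigma> t * z t 3) (at t)"
begin

lemma isCont_z: "i < 4 \<Longrightarrow> t \<in> {0<..<1} \<Longrightarrow> isCont (\<lambda>t. z t i) t"
  using deriv_z DERIV_isCont by blast

lemma cont_z_open: "i < 4 \<Longrightarrow> continuous_on {0<..<1} (\<lambda>t. z t i)"
  by (rule continuous_on_subset[OF cont_z]) auto

lemma isCont_v:
  assumes "i < 4" "t \<in> {0<..<1}"
  shows "isCont (\<lambda>t. v t i) t"
  using less_4_cases[OF assms(1)] deriv_v[OF assms(2)] DERIV_isCont by blast

text \<open>The outer indicator comes from the conclusion of \<open>weak_deriv_abs\<close>. The
  inner one cuts off \<open>v\<close>, which is arbitrary outside the open interval, so that the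
  derivative passed to that lemma is Borel measurable.\<close>

definition fold_speed :: "real \<Rightarrow> nat \<Rightarrow> real" where
  "fold_speed t i = indicator {0<..<1} t * (sgn (z t i) * (indicator {0<..<1} t * v t i))"

text \<open>The speeds may be unbounded near the collision at time 0. Their squares are at most four
  times the Lagrangian, whose integral is the finite minimal action, and this yields the
  integrability that \<open>weak_deriv_abs\<close> demands.\<close>

lemma weak_deriv_abs_z:
  assumes i: "i < 4"
  shows "weak_deriv (\<lambda>t. \<bar>z t i\<bar>) (\<lambda>t. fold_speed t i)"
proof -
  let ?g = "\<lambda>t. indicator {0<..<1} t * v t i"
  have "continuous_on {0<..<1} (\<lambda>t. v t i)"
    using isCont_v[OF i] by (auto intro: continuous_at_imp_continuous_on)
  then have m: "?g \<in> borel_measurable borel"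
    using borel_measurable_continuous_on_indicator[of "{0<..<1}" "\<lambda>t. v t i"] by simp
  have "(\<integral>\<^sup>+t\<in>{0..1}. ennreal ((norm (?g t))\<^sup>2) \<partial>lborel)
      \<le> (\<integral>\<^sup>+t. ennreal 4 * (ennreal (lagrangian (z t) (v t)) * indicator {0<..<1} t) \<partial>lborel)"
  proof (rule nn_integral_mono)
    fix t
    have "(v t i)\<^sup>2 \<le> 4 * kinetic (v t)"
      using kinetic_gap[OF i, of "\<lambda>_. 0" "v t"] kinetic_nonneg[of "\<lambda>_. 0"] by simp
    then have "(v t i)\<^sup>2 \<le> 4 * lagrangian (z t) (v t)"
      using potential_nonneg[of "z t"] unfolding lagrangian_def by simp
    then have "ennreal ((v t i)\<^sup>2) \<le> ennreal 4 * ennreal (lagrangian (z t) (v t))"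
      by (metis ennreal_leI ennreal_mult lagrangian_nonneg zero_le_numeral)
    then show "ennreal ((norm (?g t))\<^sup>2) * indicator {0..1} t
      \<le> ennreal 4 * (ennreal (lagrangian (z t) (v t)) * indicator {0<..<1} t)"
      by (auto simp: indicator_def)
  qed
  also have "\<dots> = ennreal 4 * action q1 q2 q3"
    unfolding action_lagrangian
  proof (rule nn_integral_cmult)
    have "continuous_on {0<..<1} (\<lambda>t. lagrangian (z t) (v t))"
      unfolding continuous_on_def
    proof
      fix t :: real assume t: "t \<in> {0<..<1}"
      have "((\<lambda>t. potential (z t)) \<longlongrightarrow> potential (z t)) (at t within {0<..<1})"
        by (rule potential_tendsto)
           (use t isCont_z cf in \<open>auto simp: isCont_def intro: tendsto_within_subset\<close>)
      moreover have "((\<lambda>t. v t j) \<longlongrightarrow> v t j) (at t within {0<..<1})" if "j < 4" for j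
        using isCont_v[OF that t] by (auto simp: isCont_def intro: tendsto_within_subset)
      ultimately show "((\<lambda>t. lagrangian (z t) (v t)) \<longlongrightarrow> lagrangian (z t) (v t)) (at t within {0<..<1})"
        unfolding lagrangian_def kinetic_def by (intro tendsto_intros) auto
    qed
    then have "(\<lambda>t. indicator {0<..<1} t *\<^sub>R lagrangian (z t) (v t)) \<in> borel_measurable borel"
      by (intro borel_measurable_continuous_on_indicator) auto
    then have "(\<lambda>t. ennreal (indicator {0<..<1} t *\<^sub>R lagrangian (z t) (v t))) \<in> borel_measurable borel"
      by simp
    moreover have "(\<lambda>t. ennreal (indicator {0<..<1} t *\<^sub>R lagrangian (z t) (v t))) =
      (\<lambda>t. ennreal (lagrangian (z t) (v t)) * indicator {0<..<1} t)"
      by (auto simp: indicator_def fun_eq_iff)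
    ultimately show "(\<lambda>t. ennreal (lagrangian (z t) (v t)) * indicator {0<..<1} t) \<in> borel_measurable lborel"
      by simp
  qed
  also have "\<dots> < \<infinity>" using minimizer_action_finite[OF min] by (simp add: ennreal_mult_less_top)
  finally have "set_integrable lborel {0..1} ?g" by (intro set_integrable_of_square m)
  then have ai: "?g absolutely_integrable_on {0..1}"
    using m unfolding set_integrable_def by (subst integrable_completion) auto
  show ?thesis
    unfolding fold_speed_def
    by (rule weak_deriv_abs[OF cont_z[OF i] _ m ai]) (use deriv_z[OF i] in auto)
qed

lemma weak_deriv_fold:
  assumes "weak_deriv f g"
  shows "weak_deriv (\<lambda>t. fold_sign i * f t) (\<lambda>t. fold_sign i * g t)"
  using weak_deriv_lincomb[OF assms assms, of "fold_sign i" 0] by simp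

lemma fold_sign_square: "(fold_sign i * x)\<^sup>2 = x\<^sup>2"
  by (simp add: fold_sign_def)

lemma fold_speed_square_le: "(fold_speed t i)\<^sup>2 \<le> (v t i)\<^sup>2"
  by (auto simp: fold_speed_def indicator_def sgn_if)

text \<open>Both end configurations already lie in the closed quadrants, so folding does not move
  them.\<close>

lemma fold_start_finish:
  "quadrant_fold (z 0) 0 = 0" "quadrant_fold (z 0) 1 = 0" "quadrant_fold (z 0) 2 \<ge> 0"
  "quadrant_fold (z 0) 3 = 0" "quadrant_fold (z 1) 2 = 3/2 * quadrant_fold (z 1) 0"
  "quadrant_fold (z 1) 3 = - quadrant_fold (z 1) 1 / 2"
  using start finish by (auto simp: quadrant_fold_def fold_sign_def)

lemma sign_condition:
  assumes t0: "t0 \<in> {0<..<1}"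
  shows "z t0 0 * z t0 1 * z t0 2 * z t0 3 \<le> 0"
proof (rule ccontr)
  assume "\<not> z t0 0 * z t0 1 * z t0 2 * z t0 3 \<le> 0"
  then have lt: "potential (quadrant_fold (z t0)) < potential (z t0)"
    using cf t0 by (intro potential_fold_less) auto
  \<comment> \<open>Half of the drop at t0 leaves room for continuity to keep a drop of at least
    \<epsilon> near t0.\<close>
  define \<epsilon> where "\<epsilon> = (potential (z t0) - potential (quadrant_fold (z t0))) / 2"
  have eps: "\<epsilon> > 0" using lt by (simp add: \<epsilon>_def)
  have lz: "((\<lambda>t. z t i) \<longlongrightarrow> z t0 i) (at t0)" if "i < 4" for i
    using isCont_z[OF that t0] by (simp add: isCont_def)
  have "((\<lambda>t. potential (z t) - potential (quadrant_fold (z t))) \<longlongrightarrow>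
      potential (z t0) - potential (quadrant_fold (z t0))) (at t0)"
    by (intro tendsto_diff potential_tendsto)
       (use lz cf t0 in \<open>auto simp: quadrant_fold_def intro!: tendsto_intros fold_collision_free\<close>)
  moreover have "potential (z t0) - potential (quadrant_fold (z t0)) > \<epsilon>" using lt by (simp add: \<epsilon>_def)
  ultimately have "\<forall>\<^sub>F t in at t0. \<epsilon> < potential (z t) - potential (quadrant_fold (z t))"
    by (rule order_tendstoD(1))
  then obtain \<delta> where d: "\<delta> > 0"
    "\<And>t. t \<noteq> t0 \<Longrightarrow> dist t t0 < \<delta> \<Longrightarrow> \<epsilon> < potential (z t) - potential (quadrant_fold (z t))"
    unfolding eventually_at by blast
  define b where "b = min 1 (t0 + \<delta>)"
  have b: "t0 < b" "b \<le> 1" "b \<le> t0 + \<delta>" using d t0 by (auto simp: b_def)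
  \<comment> \<open>In general only an inequality: at a zero of a component
    \<open>fold_speed\<close> is 0, whatever the speed \<open>v\<close> is.\<close>
  have k: "kinetic (\<lambda>i. fold_sign i * fold_speed t i) \<le> kinetic (v t)" for t
    unfolding kinetic_def fold_sign_square
    by (intro add_mono divide_right_mono fold_speed_square_le) auto
  show False
  proof (rule no_better_path[OF min action_lagrangian, of "\<lambda>t. quadrant_fold (z t)"
        "\<lambda>t i. fold_sign i * fold_speed t i" t0 b \<epsilon>])
    show "weak_deriv (\<lambda>t. quadrant_fold (z t) i) (\<lambda>t. fold_sign i * fold_speed t i)" if "i < 4" for i
      unfolding quadrant_fold_def using that by (intro weak_deriv_fold weak_deriv_abs_z)
    show "collision_free (quadrant_fold (z t))" if "t \<in> {0<..<1}" for t
      using that cf by (intro fold_collision_free) auto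
    show "lagrangian (quadrant_fold (z t)) (\<lambda>i. fold_sign i * fold_speed t i) \<le> lagrangian (z t) (v t)"
      if "t \<in> {0<..<1}" for t
      using potential_fold_le[of "z t"] cf that k[of t] unfolding lagrangian_def by (intro add_mono) auto
    show "lagrangian (quadrant_fold (z t)) (\<lambda>i. fold_sign i * fold_speed t i) + \<epsilon> \<le> lagrangian (z t) (v t)"
      if "t \<in> {t0<..<b}" for t
      using d(2)[of t] that b k[of t] unfolding lagrangian_def by (auto simp: dist_real_def)
  qed (use fold_start_finish b eps t0 in auto)
qed

text \<open>Otherwise $|z_i|$ has a corner at $t_0$. Replacing it by the constant $c$ between two nearby
  points $a < t_0 < b$ with $|z_i(a)| = |z_i(b)| = c$ removes the kinetic energy of this component,
  which is bounded below, while the potential changes by an amount that tends to 0 with $c$.\<close>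
lemma zero_imp_speed_zero:
  assumes i: "i < 4" and t0: "t0 \<in> {0<..<1}" and z0: "z t0 i = 0"
  shows "v t0 i = 0"
proof (rule ccontr)
  assume V: "v t0 i \<noteq> 0"
  \<comment> \<open>Near t0 the squared speed exceeds m, so the plateau saves kinetic energy of at
    least m/4. The two potential estimates of m/32 together cost at most m/16, and a net gain of
    m/16 remains.\<close>
  define m where "m = (v t0 i)\<^sup>2 / 2"
  have m: "m > 0" using V by (simp add: m_def)
  let ?L = "quadrant_fold (z t0)"
  \<comment> \<open>The competitor's configuration as a joint function of time and plateau height.
    The end points of the plateau depend on the height, so the potential must be controlled
    uniformly in time as the height tends to 0.\<close>
  let ?U = "\<lambda>p::real \<times> real. (quadrant_fold (z (fst p)))(i := fold_sign i * snd p)"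
  have cfL: "collision_free ?L" using cf t0 by (intro fold_collision_free) auto
  have lU: "((\<lambda>p. ?U p j) \<longlongrightarrow> ?L j) (nhds (t0, 0))" if "j < 4" for j
  proof (cases "j = i")
    case True
    have "((\<lambda>p. fold_sign i * snd p) \<longlongrightarrow> fold_sign i * snd (t0, 0::real)) (nhds (t0, 0))"
      by (intro tendsto_intros filterlim_ident)
    then show ?thesis using True z0 by (simp add: quadrant_fold_def)
  next
    case False
    have "((\<lambda>p. fst p) \<longlongrightarrow> fst (t0, 0::real)) (nhds (t0, 0::real))"
      by (intro tendsto_intros filterlim_ident)
    then have "((\<lambda>p. z (fst p) j) \<longlongrightarrow> z t0 j) (nhds (t0, 0::real))"
      using isCont_tendsto_compose[OF isCont_z[OF that t0]] by simp
    then have "((\<lambda>p. fold_sign j * \<bar>z (fst p) j\<bar>) \<longlongrightarrow> fold_sign j * \<bar>z t0 j\<bar>) (nhds (t0, 0::real))"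
      by (intro tendsto_intros)
    then show ?thesis using False by (simp add: quadrant_fold_def)
  qed
  have "\<forall>\<^sub>F p in nhds (t0, 0). collision_free (?U p) \<and> potential (?U p) < potential ?L + m / 32"
    by (rule eventually_conj[OF potential_tendsto(2)[OF lU cfL]
          order_tendstoD(2)[OF potential_tendsto(1)[OF lU cfL]]]) (use m in auto)
  \<comment> \<open>A neighbourhood of (t0, 0) contains a product. This decouples the two variables:
    the time window can be fixed before the height is chosen.\<close>
  then obtain P Q where P: "\<forall>\<^sub>F t in nhds t0. P t" and Q: "\<forall>\<^sub>F c in nhds (0::real). Q c"
    and PQ: "\<And>t c. P t \<Longrightarrow> Q c \<Longrightarrow> collision_free (?U (t, c)) \<and> potential (?U (t, c)) < potential ?L + m / 32"
    unfolding nhds_prod eventually_prod_filter by blast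
  obtain \<delta>c where dc: "\<delta>c > 0" "\<And>c. dist c 0 < \<delta>c \<Longrightarrow> Q c"
    using Q unfolding eventually_nhds_metric by blast
  have nh: "(f \<longlongrightarrow> f t0) (nhds t0)" if "isCont f t0" for f :: "real \<Rightarrow> real"
    using that by (simp add: isCont_def tendsto_at_iff_tendsto_nhds)
  have vn: "((\<lambda>t. v t i) \<longlongrightarrow> v t0 i) (nhds t0)" using nh[OF isCont_v[OF i t0]] .
  have e1: "\<forall>\<^sub>F t in nhds t0. (v t i)\<^sup>2 > m"
    by (rule order_tendstoD(1)[OF tendsto_power[OF vn]]) (use V in \<open>simp add: m_def\<close>)
  have e2: "\<forall>\<^sub>F t in nhds t0. v t0 i * v t i > 0"
    by (rule order_tendstoD(1)[OF tendsto_mult[OF tendsto_const vn]])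
       (use V not_real_square_gt_zero in blast)
  have lz: "((\<lambda>t. quadrant_fold (z t) j) \<longlongrightarrow> ?L j) (nhds t0)" if "j < 4" for j
    unfolding quadrant_fold_def by (intro tendsto_intros nh[OF isCont_z[OF that t0]])
  have e3: "\<forall>\<^sub>F t in nhds t0. potential (quadrant_fold (z t)) > potential ?L - m / 32"
    by (rule order_tendstoD(1)[OF potential_tendsto(1)[OF lz cfL]]) (use m in auto)
  have e4: "\<forall>\<^sub>F t in nhds t0. t \<in> {0<..<1}" using t0 by (intro eventually_nhds_in_open) auto
  have "\<forall>\<^sub>F t in nhds t0. P t \<and> (v t i)\<^sup>2 > m \<and> v t0 i * v t i > 0 \<and>
      potential (quadrant_fold (z t)) > potential ?L - m / 32 \<and> t \<in> {0<..<1}"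
    by (intro eventually_conj P e1 e2 e3 e4)
  then obtain \<delta> where d: "\<delta> > 0" and near: "\<And>t. dist t t0 < \<delta> \<Longrightarrow> P t \<and> (v t i)\<^sup>2 > m \<and>
      v t0 i * v t i > 0 \<and> potential (quadrant_fold (z t)) > potential ?L - m / 32 \<and> t \<in> {0<..<1}"
    unfolding eventually_nhds_metric by blast
  define s e where "s = t0 - \<delta> / 2" and "e = t0 + \<delta> / 2"
  have se: "s < t0" "t0 < e" using d by (auto simp: s_def e_def)
  have nr: "dist t t0 < \<delta>" if "t \<in> {s..e}" for t
    using that d by (auto simp: s_def e_def dist_real_def abs_less_iff)
  have nz: "z t i \<noteq> 0" if t: "t \<in> {s..e}" "t \<noteq> t0" for t
  proof
    assume zt: "z t i = 0"
    define x y where "x = min t t0" and "y = max t t0"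
    have xy: "x < y" "{x..y} \<subseteq> {s..e}" using t se by (auto simp: x_def y_def)
    \<comment> \<open>The factor \<open>v t0 i\<close> normalizes the direction of crossing: the
      product has positive derivative, so t0 is the only zero in the window.\<close>
    have "v t0 i * z x i < v t0 i * z y i"
    proof (rule DERIV_pos_imp_increasing[OF xy(1)])
      fix r assume "x \<le> r" "r \<le> y"
      then have r: "dist r t0 < \<delta>" using xy nr by auto
      show "\<exists>D. ((\<lambda>r. v t0 i * z r i) has_real_derivative D) (at r) \<and> 0 < D"
        using DERIV_cmult[OF deriv_z[OF i, of r], of "v t0 i"] near[OF r] by blast
    qed
    then show False using zt z0 by (auto simp: x_def y_def min_def max_def split: if_splits)
  qed
  \<comment> \<open>A height below both end values is attained on either side of t0 by the
    intermediate value theorem. Halving makes it strictly smaller than the radius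
    \<open>\<delta>c\<close>.\<close>
  define c where "c = min (min \<bar>z s i\<bar> \<bar>z e i\<bar>) \<delta>c / 2"
  have c: "c > 0" "c \<le> \<bar>z s i\<bar>" "c \<le> \<bar>z e i\<bar>" "Q c"
    using nz[of s] nz[of e] se dc by (auto simp: c_def)
  have cz: "continuous_on {s..e} (\<lambda>t. \<bar>z t i\<bar>)"
    by (intro continuous_intros continuous_on_subset[OF cont_z_open[OF i]]) (use near nr in blast)
  obtain a where a: "s \<le> a" "a \<le> t0" "\<bar>z a i\<bar> = c"
    using IVT2'[of "\<lambda>t. \<bar>z t i\<bar>" t0 c s] c z0 se continuous_on_subset[OF cz, of "{s..t0}"] by auto
  obtain b where b: "t0 \<le> b" "b \<le> e" "\<bar>z b i\<bar> = c"
    using IVT'[of "\<lambda>t. \<bar>z t i\<bar>" t0 c e] c z0 se continuous_on_subset[OF cz, of "{t0..e}"] by auto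
  have "a \<noteq> t0" using a c z0 by auto
  then have ab: "a < b" using a b by auto
  have nrab: "dist t t0 < \<delta>" if "t \<in> {a..b}" for t using that a b by (intro nr) auto
  have ab01: "0 < a" "b < 1" using near[OF nrab[of a]] near[OF nrab[of b]] ab by auto
  define u where "u t = (quadrant_fold (z t))(i := fold_sign i * (if t \<in> {a..b} then c else \<bar>z t i\<bar>))" for t
  define w where "w t = (\<lambda>j. fold_sign j * fold_speed t j)
    (i := fold_sign i * (if t \<in> {a..b} then 0 else fold_speed t i))" for t
  have u_out: "u t = quadrant_fold (z t)" if "t \<notin> {a..b}" for t
    using that by (auto simp: u_def quadrant_fold_def fun_eq_iff)
  have w_out: "w t = (\<lambda>j. fold_sign j * fold_speed t j)" if "t \<notin> {a..b}" for t
    using that by (auto simp: w_def fun_eq_iff)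
  have out: "collision_free (u t) \<and> lagrangian (u t) (w t) \<le> lagrangian (z t) (v t)"
    if t: "t \<in> {0<..<1}" "t \<notin> {a..b}" for t
  proof -
    have "kinetic (\<lambda>i. fold_sign i * fold_speed t i) \<le> kinetic (v t)"
      unfolding kinetic_def fold_sign_square
      by (intro add_mono divide_right_mono fold_speed_square_le) auto
    moreover have "collision_free (z t)" using cf t by auto
    ultimately show ?thesis
      unfolding u_out[OF t(2)] w_out[OF t(2)] lagrangian_def
      using potential_fold_le fold_collision_free by (auto intro: add_mono)
  qed
  have ins: "collision_free (u t) \<and> lagrangian (u t) (w t) + m / 16 \<le> lagrangian (z t) (v t)"
    if t: "t \<in> {a..b}" for t
  proof -
    note n = near[OF nrab[OF t]]
    have ut: "u t = ?U (t, c)" using t by (simp add: u_def)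
    have A: "collision_free (u t)" "potential (u t) < potential ?L + m / 32"
      unfolding ut using PQ[of t c] n c(4) by blast+
    have "potential ?L - m / 32 < potential (quadrant_fold (z t))" using n by blast
    moreover have "potential (quadrant_fold (z t)) \<le> potential (z t)"
      using cf n by (intro potential_fold_le) auto
    moreover have "kinetic (w t) + (v t i)\<^sup>2 / 4 \<le> kinetic (v t)"
    proof -
      have sq: "(w t j)\<^sup>2 \<le> (v t j)\<^sup>2" for j
        using fold_speed_square_le[of t j] by (auto simp: w_def fold_sign_square)
      have "w t i = 0" using t by (simp add: w_def)
      then show ?thesis using kinetic_gap[of i "w t" "v t", OF i sq] by blast
    qed
    moreover have "(v t i)\<^sup>2 > m" using n by blast
    ultimately show ?thesis using A m unfolding lagrangian_def by auto
  qed
  show False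
  proof (rule no_better_path[OF min action_lagrangian, of u w a b "m / 16"])
    show "weak_deriv (\<lambda>t. u t j) (\<lambda>t. w t j)" if j: "j < 4" for j
    proof (cases "j = i")
      case True
      show ?thesis
        unfolding u_def w_def True fun_upd_same
        by (intro weak_deriv_fold weak_deriv_flatten weak_deriv_abs_z i) (use a b ab ab01 in auto)
    next
      case False
      then show ?thesis
        using weak_deriv_fold[OF weak_deriv_abs_z[OF j]] by (simp add: u_def w_def quadrant_fold_def)
    qed
    show "collision_free (u t)" if "t \<in> {0<..<1}" for t using ins[of t] out[OF that] by blast
    show "lagrangian (u t) (w t) \<le> lagrangian (z t) (v t)" if "t \<in> {0<..<1}" for t
      using ins[of t] out[OF that] m by (cases "t \<in> {a..b}") auto
    show "lagrangian (u t) (w t) + m / 16 \<le> lagrangian (z t) (v t)" if "t \<in> {a<..<b}" for t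
      using ins[of t] that by auto
    have u01: "u 0 = quadrant_fold (z 0)" "u 1 = quadrant_fold (z 1)"
      using ab01 ab by (auto intro!: u_out)
    show "u 0 0 = 0" "u 0 1 = 0" "u 0 2 \<ge> 0" "u 0 3 = 0" "u 1 2 = 3/2 * u 1 0" "u 1 3 = - u 1 1 / 2"
      unfolding u01 by (rule fold_start_finish)+
  qed (use ab01 ab m in auto)
qed

text \<open>Here m stands for the product of the other three components. The function m(t0) z_i has
  a double zero at t0 with second derivative \<gamma> m(t0)^2 > 0, so right of t0 the component z_i
  has the sign of m, and the product of all four is positive, against
  \<open>sign_condition\<close>.\<close>

lemma isolated_zero_impossible:
  assumes i: "i < 4" and t0: "t0 \<in> {0<..<1}" and z0: "z t0 i = 0"
    and prod: "\<And>t. z t 0 * z t 1 * z t 2 * z t 3 = z t i * m t"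
    and m: "isCont m t0" "m t0 \<noteq> 0"
    and acc: "((\<lambda>t. v t i) has_real_derivative \<gamma> * m t0) (at t0)" and \<gamma>: "\<gamma> > 0"
  shows False
proof -
  have "\<forall>\<^sub>F t in at_right t0. m t0 * z t i > 0"
  proof (rule pos_right_of_strict_min[where hi=1])
    show "((\<lambda>t. m t0 * z t i) has_real_derivative m t0 * v t i) (at t)" if "t \<in> {t0..<1}" for t
      using that t0 by (intro DERIV_cmult deriv_z[OF i]) auto
    show "((\<lambda>t. m t0 * v t i) has_real_derivative m t0 * (\<gamma> * m t0)) (at t0)"
      by (rule DERIV_cmult[OF acc])
    have eq: "m t0 * (\<gamma> * m t0) = \<gamma> * (m t0)\<^sup>2" by (simp add: power2_eq_square)
    show "m t0 * (\<gamma> * m t0) > 0" unfolding eq using m \<gamma> by simp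
  qed (use t0 z0 zero_imp_speed_zero[OF i t0 z0] in auto)
  moreover have "((\<lambda>t. m t0 * m t) \<longlongrightarrow> m t0 * m t0) (at_right t0)"
    using m(1) by (intro tendsto_intros) (auto simp: isCont_def intro: tendsto_within_subset)
  then have "\<forall>\<^sub>F t in at_right t0. m t0 * m t > 0"
    by (rule order_tendstoD(1)) (use m not_real_square_gt_zero in blast)
  moreover have "\<forall>\<^sub>F t in at_right t0. t \<in> {t0<..<1}"
    using t0 by (intro eventually_at_right_real) auto
  ultimately have "\<forall>\<^sub>F t in at_right t0. False"
  proof eventually_elim
    case (elim t)
    have "0 < (m t0 * z t i) * (m t0 * m t)" using elim by simp
    also have "\<dots> = (m t0)\<^sup>2 * (z t i * m t)" by (simp add: power2_eq_square)
    finally have "z t i * m t > 0" using m by (simp add: zero_less_mult_iff)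
    then show False using sign_condition[of t] elim t0 prod[of t] by auto
  qed
  then show False by simp
qed

text \<open>The accelerations of each of these pairs are linear in the pair: for the two $x$- and the two
  $y$-components with $Z_1 \cdot Z_2$ as a coefficient, for the others because $Z_1 \cdot Z_2$ is
  itself linear in the pair.\<close>
lemma common_zeros:
  assumes t0: "t0 \<in> {0<..<1}" and t: "t \<in> {0<..<1}"
  shows "z t0 0 = 0 \<Longrightarrow> z t0 2 = 0 \<Longrightarrow> z t 0 = 0 \<and> z t 2 = 0"
    and "z t0 1 = 0 \<Longrightarrow> z t0 3 = 0 \<Longrightarrow> z t 1 = 0 \<and> z t 3 = 0"
    and "z t0 0 = 0 \<Longrightarrow> z t0 3 = 0 \<Longrightarrow> z t 0 = 0 \<and> z t 3 = 0"
    and "z t0 1 = 0 \<Longrightarrow> z t0 2 = 0 \<Longrightarrow> z t 1 = 0 \<and> z t 2 = 0"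
    and "z t0 2 = 0 \<Longrightarrow> z t0 3 = 0 \<Longrightarrow> z t 2 = 0 \<and> z t 3 = 0"
proof -
  have c: "continuous_on {0<..<1} (\<lambda>t. z t 0)" "continuous_on {0<..<1} (\<lambda>t. z t 1)"
    "continuous_on {0<..<1} (\<lambda>t. z t 2)" "continuous_on {0<..<1} (\<lambda>t. z t 3)"
    by (rule cont_z_open; simp)+
  \<comment> \<open>By \<open>zero_imp_speed_zero\<close> the speeds vanish together with the
    positions, so two zeros already give the full zero initial data of the linear system.\<close>
  have linear: "z t i = 0 \<and> z t j = 0"
    if i: "i < 4" and j: "j < 4" and init: "z t0 i = 0" "z t0 j = 0"
      and ai: "\<And>t. t \<in> {0<..<1} \<Longrightarrow> ((\<lambda>t. v t i) has_real_derivative A t * z t i + B t * z t j) (at t)"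
      and aj: "\<And>t. t \<in> {0<..<1} \<Longrightarrow> ((\<lambda>t. v t j) has_real_derivative C t * z t i + D t * z t j) (at t)"
      and cc: "continuous_on {0<..<1} A" "continuous_on {0<..<1} B" "continuous_on {0<..<1} C"
        "continuous_on {0<..<1} D"
    for i j A B C D
    using linear_ode_pair_zero[OF deriv_z[OF i] deriv_z[OF j] ai aj cc t0 init
        zero_imp_speed_zero[OF i t0 init(1)] zero_imp_speed_zero[OF j t0 init(2)] t] by blast
  let ?x = "\<lambda>t. z t 0 * z t 2 + z t 1 * z t 3"
  show "z t 0 = 0 \<and> z t 2 = 0" if "z t0 0 = 0" "z t0 2 = 0"
    by (rule linear[of 0 2 "\<lambda>t. - \<alpha> t" "\<lambda>t. \<kappa> t * ?x t" "\<lambda>t. 3/4 * \<kappa> t * ?x t" "\<lambda>t. - \<sigma> t"])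
       (use that deriv_v in \<open>auto intro!: continuous_intros coeff c simp: algebra_simps simp del: One_nat_def\<close>)
  show "z t 1 = 0 \<and> z t 3 = 0" if "z t0 1 = 0" "z t0 3 = 0"
    by (rule linear[of 1 3 "\<lambda>t. - \<alpha> t" "\<lambda>t. \<kappa> t * ?x t" "\<lambda>t. 3/4 * \<kappa> t * ?x t" "\<lambda>t. - \<sigma> t"])
       (use that deriv_v in \<open>auto intro!: continuous_intros coeff c simp: algebra_simps simp del: One_nat_def\<close>)
  show "z t 0 = 0 \<and> z t 3 = 0" if "z t0 0 = 0" "z t0 3 = 0"
    by (rule linear[of 0 3 "\<lambda>t. \<kappa> t * z t 2 * z t 2 - \<alpha> t" "\<lambda>t. \<kappa> t * z t 1 * z t 2"
          "\<lambda>t. 3/4 * \<kappa> t * z t 2 * z t 1" "\<lambda>t. 3/4 * \<kappa> t * z t 1 * z t 1 - \<sigma> t"])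
       (use that deriv_v in \<open>auto intro!: continuous_intros coeff c simp: algebra_simps simp del: One_nat_def\<close>)
  show "z t 1 = 0 \<and> z t 2 = 0" if "z t0 1 = 0" "z t0 2 = 0"
    by (rule linear[of 1 2 "\<lambda>t. \<kappa> t * z t 3 * z t 3 - \<alpha> t" "\<lambda>t. \<kappa> t * z t 0 * z t 3"
          "\<lambda>t. 3/4 * \<kappa> t * z t 3 * z t 0" "\<lambda>t. 3/4 * \<kappa> t * z t 0 * z t 0 - \<sigma> t"])
       (use that deriv_v in \<open>auto intro!: continuous_intros coeff c simp: algebra_simps simp del: One_nat_def\<close>)
  show "z t 2 = 0 \<and> z t 3 = 0" if "z t0 2 = 0" "z t0 3 = 0"
    by (rule linear[of 2 3 "\<lambda>t. 3/4 * \<kappa> t * z t 0 * z t 0 - \<sigma> t" "\<lambda>t. 3/4 * \<kappa> t * z t 1 * z t 0"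
          "\<lambda>t. 3/4 * \<kappa> t * z t 0 * z t 1" "\<lambda>t. 3/4 * \<kappa> t * z t 1 * z t 1 - \<sigma> t"])
       (use that deriv_v in \<open>auto intro!: continuous_intros coeff c simp: algebra_simps simp del: One_nat_def\<close>)
qed

section \<open>Constant signs of the four components\<close>

lemma z_nonneg:
  assumes "i < 4" "\<forall>t\<in>{0<..<1}. z t i \<ge> 0" "t \<in> {0..1}"
  shows "z t i \<ge> 0"
  using nonneg_on_closed_interval[OF cont_z[OF assms(1)] _ assms(3)] assms(2) by blast

lemma z_nonpos:
  assumes "i < 4" "\<forall>t\<in>{0<..<1}. z t i \<le> 0" "t \<in> {0..1}"
  shows "z t i \<le> 0"
proof -
  have "continuous_on {0..1} (\<lambda>t. - z t i)" by (intro continuous_intros cont_z assms)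
  from nonneg_on_closed_interval[OF this _ assms(3)] show ?thesis using assms(2) by simp
qed

lemma z2_not_identically_zero: "\<not> (\<forall>t\<in>{0<..<1}. z t 2 = 0)"
proof
  assume "\<forall>t\<in>{0<..<1}. z t 2 = 0"
  then have "z 0 2 \<le> 0" by (intro z_nonpos) auto
  then show False using start by simp
qed

text \<open>By continuity Z_1x(1) = Z_2y(1) = 0, and the end condition Z_2y(1) = - Z_1y(1)/2 then
  gives Z_1(1) = 0, a collision of bodies 1 and 2.\<close>

lemma z0_z3_not_identically_zero: "\<not> (\<forall>t\<in>{0<..<1}. z t 0 = 0 \<and> z t 3 = 0)"
proof
  assume *: "\<forall>t\<in>{0<..<1}. z t 0 = 0 \<and> z t 3 = 0"
  have "z 1 0 \<le> 0" by (rule z_nonpos) (use * in auto)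
  moreover have "z 1 3 \<ge> 0" by (rule z_nonneg) (use * in auto)
  ultimately have "z 1 0 = 0" "z 1 1 = 0" using finish by auto
  then have "sq12 (z 1) = 0" by (simp add: sq12_def)
  then show False using cf[of 1] by (simp add: collision_free_def)
qed

text \<open>At a zero of an x-component no other component can vanish: a common zero would be a
  collision or spread over the whole interval by \<open>common_zeros\<close>, against the end
  conditions. An isolated zero contradicts the sign condition.\<close>

lemma x_nonzero:
  assumes t: "t \<in> {0<..<1}"
  shows "z t 0 \<noteq> 0" "z t 2 \<noteq> 0"
proof -
  have k: "\<kappa> t > 0" "3/4 * \<kappa> t > 0" using kappa_pos[OF t] by auto
  have "sq12 (z t) > 0" using cf[of t] t by (simp add: collision_free_def)
  then have coll: "z t 0 \<noteq> 0 \<or> z t 1 \<noteq> 0" by (auto simp: sq12_def)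
  have c: "isCont (\<lambda>t. z t 0) t" "isCont (\<lambda>t. z t 1) t" "isCont (\<lambda>t. z t 2) t" "isCont (\<lambda>t. z t 3) t"
    by (rule isCont_z[OF _ t]; simp)+
  have z02: "z t 0 \<noteq> 0 \<or> z t 2 \<noteq> 0"
    using common_zeros(1)[OF t] z2_not_identically_zero by blast
  show "z t 0 \<noteq> 0"
  proof
    assume z0: "z t 0 = 0"
    have z: "z t 1 \<noteq> 0" "z t 2 \<noteq> 0" "z t 3 \<noteq> 0"
      using z0 coll z02 common_zeros(3)[OF t] z0_z3_not_identically_zero by blast+
    show False
    proof (rule isolated_zero_impossible[of 0 t "\<lambda>t. z t 1 * z t 2 * z t 3" "\<kappa> t"])
      \<comment> \<open>With Z_1x = 0 the \<alpha>-term drops out and Z_1 . Z_2 reduces to Z_1y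
        Z_2y, so the acceleration is \<kappa> times the product of the other three components. The
        remaining cases follow the same pattern, with 3/4 \<kappa> for Z_2.\<close>
      show "((\<lambda>t. v t 0) has_real_derivative \<kappa> t * (z t 1 * z t 2 * z t 3)) (at t)"
        using deriv_v(1)[OF t] z0 by (simp add: mult_ac)
    qed (use z0 z k t c in \<open>auto intro!: continuous_intros\<close>)
  qed
  show "z t 2 \<noteq> 0"
  proof
    assume z2: "z t 2 = 0"
    have z: "z t 0 \<noteq> 0" "z t 1 \<noteq> 0" "z t 3 \<noteq> 0"
      using z2 z02 common_zeros(4,5)[OF t] z2_not_identically_zero by blast+
    show False
    proof (rule isolated_zero_impossible[of 2 t "\<lambda>t. z t 0 * z t 1 * z t 3" "3/4 * \<kappa> t"])
      show "((\<lambda>t. v t 2) has_real_derivative 3/4 * \<kappa> t * (z t 0 * z t 1 * z t 3)) (at t)"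
        using deriv_v(3)[OF t] z2 by (simp add: mult_ac)
    qed (use z2 z k t c in \<open>auto intro!: continuous_intros\<close>)
  qed
qed

text \<open>The x-components do not vanish, so a zero of one y-component alone would be isolated,
  which is impossible. A common zero spreads by linearity and gives the collinear motion, which is
  compatible with the end conditions.\<close>

lemma y_dichotomy:
  "(\<forall>t\<in>{0<..<1}. z t 1 = 0 \<and> z t 3 = 0) \<or> (\<forall>t\<in>{0<..<1}. z t 1 \<noteq> 0 \<and> z t 3 \<noteq> 0)"
proof -
  have *: "z t 1 = 0 \<longleftrightarrow> z t 3 = 0" if t: "t \<in> {0<..<1}" for t
  proof -
    have k: "\<kappa> t > 0" "3/4 * \<kappa> t > 0" using kappa_pos[OF t] by auto
    have c: "isCont (\<lambda>t. z t 0) t" "isCont (\<lambda>t. z t 1) t" "isCont (\<lambda>t. z t 2) t" "isCont (\<lambda>t. z t 3) t"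
      by (rule isCont_z[OF _ t]; simp)+
    note x = x_nonzero[OF t]
    have False if z: "z t 1 = 0" "z t 3 \<noteq> 0"
    proof (rule isolated_zero_impossible[of 1 t "\<lambda>t. z t 0 * z t 2 * z t 3" "\<kappa> t"])
      show "((\<lambda>t. v t 1) has_real_derivative \<kappa> t * (z t 0 * z t 2 * z t 3)) (at t)"
        using deriv_v(2)[OF t] z by (simp add: mult_ac)
    qed (use x z k t c in \<open>auto intro!: continuous_intros\<close>)
    moreover have False if z: "z t 3 = 0" "z t 1 \<noteq> 0"
    proof (rule isolated_zero_impossible[of 3 t "\<lambda>t. z t 0 * z t 1 * z t 2" "3/4 * \<kappa> t"])
      show "((\<lambda>t. v t 3) has_real_derivative 3/4 * \<kappa> t * (z t 0 * z t 1 * z t 2)) (at t)"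
        using deriv_v(4)[OF t] z by (simp add: mult_ac)
    qed (use x z k t c in \<open>auto intro!: continuous_intros\<close>)
    ultimately show ?thesis by blast
  qed
  show ?thesis
  proof (cases "\<exists>t\<in>{0<..<1}. z t 1 = 0")
    case True
    then obtain t where "t \<in> {0<..<1}" "z t 1 = 0" "z t 3 = 0" using * by blast
    then show ?thesis using common_zeros(2)[of t] by blast
  qed (use * in blast)
qed

text \<open>The signs are pinned at the ends: Z_1x at time 1, Z_2x at time 0. The y-components have
  opposite signs by \<open>sign_condition\<close>; the two orientations are mirror images in the
  x-axis, and Z_1y(1) > 0 decides between them.\<close>

lemma quadrants:
  assumes x1: "z 1 0 > 0"
  shows "\<forall>t\<in>{0..1}. z t 0 \<ge> 0 \<and> z t 2 \<ge> 0"
    and "(\<forall>t\<in>{0..1}. z t 1 \<ge> 0 \<and> z t 3 \<le> 0) \<or> (\<forall>t\<in>{0..1}. z t 1 \<le> 0 \<and> z t 3 \<ge> 0)"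
    and "z 1 1 > 0 \<Longrightarrow> \<forall>t\<in>{0..1}. z t 1 \<ge> 0 \<and> z t 3 \<le> 0"
proof -
  have ge: "\<forall>t\<in>{0..1}. z t i \<ge> 0" if "i < 4" "\<forall>t\<in>{0<..<1}. z t i \<ge> 0" for i
    using z_nonneg that by blast
  have le: "\<forall>t\<in>{0..1}. z t i \<le> 0" if "i < 4" "\<forall>t\<in>{0<..<1}. z t i \<le> 0" for i
    using z_nonpos that by blast
  have sign: "(\<forall>t\<in>{0<..<1}. z t i > 0) \<or> (\<forall>t\<in>{0<..<1}. z t i < 0)"
    if "i < 4" "\<And>t. t \<in> {0<..<1} \<Longrightarrow> z t i \<noteq> 0" for i
    using nonzero_constant_sign[OF cont_z[OF that(1)] that(2)] by blast
  have p0: "\<forall>t\<in>{0<..<1}. z t 0 > 0"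
  proof (rule ccontr)
    assume "\<not> ?thesis"
    then have "\<forall>t\<in>{0<..<1}. z t 0 < 0" using sign[of 0] x_nonzero(1) by auto
    then have "z 1 0 \<le> 0" by (intro z_nonpos) (auto simp: less_imp_le)
    then show False using x1 by simp
  qed
  have p2: "\<forall>t\<in>{0<..<1}. z t 2 > 0"
  proof (rule ccontr)
    assume "\<not> ?thesis"
    then have "\<forall>t\<in>{0<..<1}. z t 2 < 0" using sign[of 2] x_nonzero(2) by auto
    then have "z 0 2 \<le> 0" by (intro z_nonpos) (auto simp: less_imp_le)
    then show False using start by simp
  qed
  show "\<forall>t\<in>{0..1}. z t 0 \<ge> 0 \<and> z t 2 \<ge> 0"
    using ge[of 0] ge[of 2] p0 p2 by (simp add: less_imp_le)
  show y: "(\<forall>t\<in>{0..1}. z t 1 \<ge> 0 \<and> z t 3 \<le> 0) \<or> (\<forall>t\<in>{0..1}. z t 1 \<le> 0 \<and> z t 3 \<ge> 0)"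
    using y_dichotomy
  proof
    assume "\<forall>t\<in>{0<..<1}. z t 1 = 0 \<and> z t 3 = 0"
    then show ?thesis using ge[of 1] le[of 3] by simp
  next
    assume nz: "\<forall>t\<in>{0<..<1}. z t 1 \<noteq> 0 \<and> z t 3 \<noteq> 0"
    have neg: "z t 1 * z t 3 \<le> 0" if t: "t \<in> {0<..<1}" for t
    proof (rule ccontr)
      assume "\<not> z t 1 * z t 3 \<le> 0"
      then have "z t 1 * z t 3 > 0" by simp
      moreover have "z t 0 * z t 2 > 0" using p0 p2 t by simp
      ultimately have "(z t 0 * z t 2) * (z t 1 * z t 3) > 0" by (rule mult_pos_pos[rotated])
      then show False using sign_condition[OF t] by (simp add: mult_ac)
    qed
    have "z t 3 < 0" if "t \<in> {0<..<1}" "z t 1 > 0" for t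
      using that neg[of t] nz by (auto simp: mult_le_0_iff less_le)
    moreover have "z t 3 > 0" if "t \<in> {0<..<1}" "z t 1 < 0" for t
      using that neg[of t] nz by (auto simp: mult_le_0_iff less_le)
    moreover have "(\<forall>t\<in>{0<..<1}. z t 1 > 0) \<or> (\<forall>t\<in>{0<..<1}. z t 1 < 0)"
      using sign[of 1] nz by auto
    ultimately consider "\<forall>t\<in>{0<..<1}. z t 1 > 0 \<and> z t 3 < 0" | "\<forall>t\<in>{0<..<1}. z t 1 < 0 \<and> z t 3 > 0"
      by blast
    then show ?thesis
    proof cases
      case 1
      then show ?thesis using ge[of 1] le[of 3] by (simp add: less_imp_le)
    next
      case 2
      then show ?thesis using le[of 1] ge[of 3] by (simp add: less_imp_le)
    qed
  qed
  show "\<forall>t\<in>{0..1}. z t 1 \<ge> 0 \<and> z t 3 \<le> 0" if "z 1 1 > 0"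
    using y
  proof
    assume "\<forall>t\<in>{0..1}. z t 1 \<le> 0 \<and> z t 3 \<ge> 0"
    then have "z 1 1 \<le> 0" by simp
    then show ?thesis using that by simp
  qed
qed

end

section \<open>Newton's equations in Jacobi coordinates\<close>

text \<open>Linear in the three vectors, so it serves positions, velocities and accelerations alike.
  Indices above 3 repeat the last component, which lets facts about it hold for every index.\<close>

definition jacobi :: "pt \<Rightarrow> pt \<Rightarrow> pt \<Rightarrow> nat \<Rightarrow> real" where
  "jacobi x1 x2 x3 i =
    (if i = 0 then fst (x1 - x2) else if i = 1 then snd (x1 - x2)
     else if i = 2 then fst (x3 - (1/2) *\<^sub>R (x1 + x2)) else snd (x3 - (1/2) *\<^sub>R (x1 + x2)))"

lemma body_jacobi:
  assumes "x1 + x2 + x3 = 0"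
  shows "body1 (jacobi x1 x2 x3) = x1" "body2 (jacobi x1 x2 x3) = x2" "body3 (jacobi x1 x2 x3) = x3"
proof -
  have x3: "x3 = - x1 - x2" using assms by (simp add: eq_neg_iff_add_eq_0 add_ac algebra_simps)
  show "body1 (jacobi x1 x2 x3) = x1" "body2 (jacobi x1 x2 x3) = x2" "body3 (jacobi x1 x2 x3) = x3"
    unfolding x3 by (auto simp: body1_def body2_def body3_def jacobi_def prod_eq_iff field_simps)
qed

lemma jacobi_has_real_derivative:
  assumes "(x1 has_vector_derivative y1) (at t)" "(x2 has_vector_derivative y2) (at t)"
    "(x3 has_vector_derivative y3) (at t)"
  shows "((\<lambda>t. jacobi (x1 t) (x2 t) (x3 t) i) has_real_derivative jacobi y1 y2 y3 i) (at t)"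
proof -
  have "((\<lambda>t. x1 t - x2 t) has_vector_derivative y1 - y2) (at t)"
    "((\<lambda>t. x3 t - (1/2) *\<^sub>R (x1 t + x2 t)) has_vector_derivative y3 - (1/2) *\<^sub>R (y1 + y2)) (at t)"
    using assms by (auto intro!: derivative_eq_intros)
  note d = this
  note f = d[THEN bounded_linear.has_vector_derivative[OF bounded_linear_fst]]
  note s = d[THEN bounded_linear.has_vector_derivative[OF bounded_linear_snd]]
  show ?thesis
    unfolding jacobi_def has_real_derivative_iff_has_vector_derivative
    using f s by (cases "i = 0"; cases "i = 1"; cases "i = 2") (simp_all del: fst_diff snd_diff)
qed

text \<open>The argument is a squared distance, so the value is the inverse cube of the
  distance.\<close>

definition inv_cube :: "real \<Rightarrow> real" where
  "inv_cube x = 1 / (sqrt x) ^ 3"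

definition attraction1 :: "(nat \<Rightarrow> real) \<Rightarrow> real" where
  "attraction1 u = 2 * inv_cube (sq12 u) + (inv_cube (sq13 u) + inv_cube (sq23 u)) / 2"

definition attraction2 :: "(nat \<Rightarrow> real) \<Rightarrow> real" where
  "attraction2 u = 3/2 * (inv_cube (sq13 u) + inv_cube (sq23 u))"

text \<open>This is $(r_{13}^{-3} - r_{23}^{-3}) / (Z_1 \cdot Z_2)$ in a form without singularity at
  $Z_1 \cdot Z_2 = 0$, using $r_{23}^2 - r_{13}^2 = 2 Z_1 \cdot Z_2$.\<close>
definition coupling :: "(nat \<Rightarrow> real) \<Rightarrow> real" where
  "coupling u = 2 * (sq13 u + sqrt (sq13 u) * sqrt (sq23 u) + sq23 u)
     / ((sqrt (sq13 u) + sqrt (sq23 u)) * (sqrt (sq13 u) * sqrt (sq23 u)) ^ 3)"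

text \<open>In s^3 - r^3 the factor s - r is traded for (s^2 - r^2) / (r + s), and s^2 - r^2 is
  twice the inner product Z_1 . Z_2.\<close>

lemma inv_cube_diff:
  assumes "collision_free u"
  shows "inv_cube (sq13 u) - inv_cube (sq23 u) = coupling u * (u 0 * u 2 + u 1 * u 3)"
proof -
  define r s where "r = sqrt (sq13 u)" and "s = sqrt (sq23 u)"
  have rs: "r > 0" "s > 0" "sq13 u = r\<^sup>2" "sq23 u = s\<^sup>2"
    using assms by (auto simp: collision_free_def r_def s_def)
  have x: "u 0 * u 2 + u 1 * u 3 = (s\<^sup>2 - r\<^sup>2) / 2"
    using sq13_eq[of u] sq23_eq[of u] rs by simp
  have "inv_cube (sq13 u) - inv_cube (sq23 u) = 1 / r ^ 3 - 1 / s ^ 3"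
    by (simp add: inv_cube_def r_def s_def)
  also have "\<dots> = (s ^ 3 - r ^ 3) / (r * s) ^ 3"
    using rs by (simp add: field_simps)
  also have "s ^ 3 - r ^ 3 = (r\<^sup>2 + r * s + s\<^sup>2) * (s\<^sup>2 - r\<^sup>2) / (r + s)"
    using rs by (simp add: field_simps power2_eq_square power3_eq_cube)
  also have "\<dots> / (r * s) ^ 3 = 2 * (r\<^sup>2 + r * s + s\<^sup>2) / ((r + s) * (r * s) ^ 3) * ((s\<^sup>2 - r\<^sup>2) / 2)"
  proof -
    have "X * Y / Z / W = 2 * X / (Z * W) * (Y / 2)" for X Y Z W :: real by simp
    then show ?thesis .
  qed
  also have "\<dots> = coupling u * (u 0 * u 2 + u 1 * u 3)"
    unfolding coupling_def x r_def[symmetric] s_def[symmetric] by (simp only: rs(3,4))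
  finally show ?thesis .
qed

lemma coupling_pos: "collision_free u \<Longrightarrow> coupling u > 0"
  unfolding collision_free_def coupling_def
  by (intro divide_pos_pos mult_pos_pos add_pos_pos zero_less_power) auto

text \<open>With S and T the inverse cubes of r_13 and r_23, Newton's equations give Z_1'' = (S - T)
  Z_2 - \<open>attraction1\<close> Z_1 and Z_2'' = 3/4 (S - T) Z_1 - \<open>attraction2\<close> Z_2.
  By \<open>inv_cube_diff\<close>, S - T is a positive multiple of Z_1 . Z_2.\<close>

lemma jacobi_force:
  fixes u :: "nat \<Rightarrow> real"
  assumes cf: "collision_free u"
  defines "a \<equiv> jacobi (force (body1 u) (body2 u) (body3 u)) (force (body2 u) (body1 u) (body3 u))
    (force (body3 u) (body1 u) (body2 u))"
  shows "a 0 = coupling u * (u 0 * u 2 + u 1 * u 3) * u 2 - attraction1 u * u 0"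
    "a 1 = coupling u * (u 0 * u 2 + u 1 * u 3) * u 3 - attraction1 u * u 1"
    "a 2 = 3/4 * coupling u * (u 0 * u 2 + u 1 * u 3) * u 0 - attraction2 u * u 2"
    "a 3 = 3/4 * coupling u * (u 0 * u 2 + u 1 * u 3) * u 1 - attraction2 u * u 3"
proof -
  define R S T where "R = inv_cube (sq12 u)" and "S = inv_cube (sq13 u)" and "T = inv_cube (sq23 u)"
  have n: "norm (body2 u - body1 u) = sqrt (sq12 u)" "norm (body1 u - body2 u) = sqrt (sq12 u)"
    "norm (body3 u - body1 u) = sqrt (sq13 u)" "norm (body1 u - body3 u) = sqrt (sq13 u)"
    "norm (body3 u - body2 u) = sqrt (sq23 u)" "norm (body2 u - body3 u) = sqrt (sq23 u)"
    using dist_bodies[of u] by (simp_all add: dist_norm norm_minus_commute)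
  have f: "force (body1 u) (body2 u) (body3 u) = R *\<^sub>R (body2 u - body1 u) + S *\<^sub>R (body3 u - body1 u)"
    "force (body2 u) (body1 u) (body3 u) = R *\<^sub>R (body1 u - body2 u) + T *\<^sub>R (body3 u - body2 u)"
    "force (body3 u) (body1 u) (body2 u) = S *\<^sub>R (body1 u - body3 u) + T *\<^sub>R (body2 u - body3 u)"
    unfolding force_def n R_def S_def T_def inv_cube_def by simp_all
  have d: "coupling u * (u 0 * u 2 + u 1 * u 3) = S - T"
    using inv_cube_diff[OF cf] by (simp add: S_def T_def)
  have d': "3/4 * coupling u * (u 0 * u 2 + u 1 * u 3) = 3/4 * (S - T)"
    using d by (simp add: mult.assoc)
  have "a 0 = (S - T) * u 2 - (2 * R + (S + T) / 2) * u 0"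
    "a 1 = (S - T) * u 3 - (2 * R + (S + T) / 2) * u 1"
    "a 2 = 3/4 * (S - T) * u 0 - 3/2 * (S + T) * u 2"
    "a 3 = 3/4 * (S - T) * u 1 - 3/2 * (S + T) * u 3"
    unfolding a_def f unfolding jacobi_def body1_def body2_def body3_def by (simp_all add: field_simps)
  then show "a 0 = coupling u * (u 0 * u 2 + u 1 * u 3) * u 2 - attraction1 u * u 0"
    "a 1 = coupling u * (u 0 * u 2 + u 1 * u 3) * u 3 - attraction1 u * u 1"
    "a 2 = 3/4 * coupling u * (u 0 * u 2 + u 1 * u 3) * u 0 - attraction2 u * u 2"
    "a 3 = 3/4 * coupling u * (u 0 * u 2 + u 1 * u 3) * u 1 - attraction2 u * u 3"
    unfolding d d' attraction1_def attraction2_def R_def S_def T_def by simp_all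
qed

lemma continuous_on_coefficients:
  assumes c: "\<And>i. i < 4 \<Longrightarrow> continuous_on S (\<lambda>t. z t i)" and cf: "\<And>t. t \<in> S \<Longrightarrow> collision_free (z t)"
  shows "continuous_on S (\<lambda>t. attraction1 (z t))" "continuous_on S (\<lambda>t. attraction2 (z t))"
    "continuous_on S (\<lambda>t. coupling (z t))"
proof -
  have z: "continuous_on S (\<lambda>t. z t 0)" "continuous_on S (\<lambda>t. z t 1)"
    "continuous_on S (\<lambda>t. z t 2)" "continuous_on S (\<lambda>t. z t 3)"
    by (rule c; simp)+
  have sq: "continuous_on S (\<lambda>t. sq12 (z t))" "continuous_on S (\<lambda>t. sq13 (z t))"
    "continuous_on S (\<lambda>t. sq23 (z t))"
    unfolding sq12_def sq13_def sq23_def by (intro continuous_intros z; simp)+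
  have pos: "sq12 (z t) \<noteq> 0 \<and> sq13 (z t) \<noteq> 0 \<and> sq23 (z t) \<noteq> 0
      \<and> sqrt (sq13 (z t)) + sqrt (sq23 (z t)) \<noteq> 0" if "t \<in> S" for t
    using cf[OF that] unfolding collision_free_def
    by (metis add_pos_pos order_less_irrefl real_sqrt_gt_0_iff)
  show "continuous_on S (\<lambda>t. attraction1 (z t))" "continuous_on S (\<lambda>t. attraction2 (z t))"
    "continuous_on S (\<lambda>t. coupling (z t))"
    unfolding attraction1_def attraction2_def coupling_def inv_cube_def
    by (intro continuous_intros sq; use pos in simp)+
qed

lemma H1_path_continuous_on:
  assumes "H1_path f"
  shows "continuous_on {0..1} f"
proof -
  obtain g where g: "set_integrable lborel {0..1} g"
    and f: "\<forall>t\<in>{0..1}. f t = f 0 + (LINT s:{0..t}|lborel. g s)"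
    using assms unfolding H1_path_def by blast
  have c: "continuous_on {0..1} (\<lambda>t. f 0 + integral {0..t} g)"
    using set_borel_integral_eq_integral(1)[OF g]
    by (intro continuous_intros indefinite_integral_continuous_1)
  have e: "f 0 + integral {0..t} g = f t" if t: "t \<in> {0..1}" for t
  proof -
    have "set_integrable lborel {0..t} g" by (rule set_integrable_subset[OF g]) (use t in auto)
    from set_borel_integral_eq_integral(2)[OF this] show ?thesis using f t by metis
  qed
  show ?thesis by (rule continuous_on_eq[OF c e])
qed

lemma closure_quadrant1: "closure quadrant1 = {p. fst p \<ge> 0 \<and> snd p \<ge> 0}"
proof -
  have q: "quadrant1 = {0<..} \<times> {0<..}" by (auto simp: quadrant1_def)
  show ?thesis unfolding q closure_Times by auto
qed

lemma closure_quadrant4: "closure quadrant4 = {p. fst p \<ge> 0 \<and> snd p \<le> 0}"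
proof -
  have q: "quadrant4 = {0<..} \<times> {..<0}" by (auto simp: quadrant4_def)
  show ?thesis unfolding q closure_Times by auto
qed

theorem theorem5p8:
  fixes q1 q2 q3 Z1 Z2 :: "real \<Rightarrow> real \<times> real"
  assumes min: "minimizer q1 q2 q3"
    and collfree: "\<forall>t\<in>{0<..1}. q1 t \<noteq> q2 t \<and> q1 t \<noteq> q3 t \<and> q2 t \<noteq> q3 t"
    and newton: "newton_on {0<..<1} q1 q2 q3"
    and Z1_def: "\<And>t. Z1 t = q1 t - q2 t"
    and Z2_def: "\<And>t. Z2 t = q3 t - (1/2) *\<^sub>R (q1 t + q2 t)"
    and Z1_0: "Z1 0 = 0"
    and Z2_0: "Z2 0 \<in> pos_x_axis"
    and Z1_1: "Z1 1 \<in> closure quadrant1"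
    and Z2_1: "Z2 1 \<in> closure quadrant4"
  shows "(Z1 1 \<in> quadrant1 \<or> Z2 1 \<in> quadrant4 \<longrightarrow>
            (\<forall>t\<in>{0..1}. Z1 t \<in> closure quadrant1 \<and> Z2 t \<in> closure quadrant4))
       \<and> (Z1 1 \<in> pos_x_axis \<and> Z2 1 \<in> pos_x_axis \<longrightarrow>
            ((\<forall>t\<in>{0..1}. Z1 t \<in> closure quadrant1 \<and> Z2 t \<in> closure quadrant4) \<or>
             (\<forall>t\<in>{0..1}. Z1 t \<in> closure quadrant4 \<and> Z2 t \<in> closure quadrant1)))"
proof -
  define z where "z t = jacobi (q1 t) (q2 t) (q3 t)" for t
  have z: "z t 0 = fst (Z1 t)" "z t 1 = snd (Z1 t)" "z t 2 = fst (Z2 t)" "z t 3 = snd (Z2 t)" for t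
    by (simp_all add: z_def jacobi_def Z1_def Z2_def)
  have adm: "admissible q1 q2 q3" using min by (simp add: minimizer_def)
  have com: "q1 t + q2 t + q3 t = 0" if "t \<in> {0..1}" for t
    using adm that unfolding admissible_def by blast
  have pos: "q1 t = body1 (z t) \<and> q2 t = body2 (z t) \<and> q3 t = body3 (z t)" if "t \<in> {0..1}" for t
    unfolding z_def using body_jacobi[OF com[OF that]] by simp
  have cf: "collision_free (z t)" if "t \<in> {0<..1}" for t
    using bspec[OF collfree that] pos[of t] that unfolding collision_free_iff by simp
  obtain v1 v2 v3 where N: "\<forall>t\<in>{0<..<1}.
      (q1 has_vector_derivative v1 t) (at t) \<and> (q2 has_vector_derivative v2 t) (at t) \<and>
      (q3 has_vector_derivative v3 t) (at t) \<and>
      (v1 has_vector_derivative force (q1 t) (q2 t) (q3 t)) (at t) \<and>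
      (v2 has_vector_derivative force (q2 t) (q1 t) (q3 t)) (at t) \<and>
      (v3 has_vector_derivative force (q3 t) (q1 t) (q2 t)) (at t)"
    using newton unfolding newton_on_def by blast
  define v where "v t = jacobi (v1 t) (v2 t) (v3 t)" for t
  have speed: "v1 t = body1 (v t) \<and> v2 t = body2 (v t) \<and> v3 t = body3 (v t)" if t: "t \<in> {0<..<1}" for t
  proof -
    \<comment> \<open>The centre of mass rests at the origin on the unit interval, so on its
      interior the velocities sum to zero and \<open>body_jacobi\<close> applies to them
      too.\<close>
    have "((\<lambda>t. q1 t + q2 t + q3 t) has_vector_derivative v1 t + v2 t + v3 t) (at t)"
      using N t by (auto intro!: derivative_eq_intros)
    then have "((\<lambda>_. 0) has_vector_derivative v1 t + v2 t + v3 t) (at t)"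
      by (rule has_vector_derivative_transform_within_open[of _ _ _ "{0<..<1}"])
         (use t com in auto)
    then have "v1 t + v2 t + v3 t = 0"
      using vector_derivative_unique_at has_vector_derivative_const by blast
    then show ?thesis unfolding v_def using body_jacobi by simp
  qed
  have H1: "H1_path q1" "H1_path q2" "H1_path q3" using adm unfolding admissible_def by auto
  have cont: "continuous_on {0..1} (\<lambda>t. z t i)" for i
    unfolding z_def jacobi_def using H1[THEN H1_path_continuous_on]
    by (cases "i = 0"; cases "i = 1"; cases "i = 2") (auto intro!: continuous_intros)
  have acc: "((\<lambda>t. v t i) has_real_derivative
      jacobi (force (body1 (z t)) (body2 (z t)) (body3 (z t))) (force (body2 (z t)) (body1 (z t)) (body3 (z t)))
        (force (body3 (z t)) (body1 (z t)) (body2 (z t))) i) (at t)" if t: "t \<in> {0<..<1}" for t i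
  proof -
    have p: "q1 t = body1 (z t)" "q2 t = body2 (z t)" "q3 t = body3 (z t)" using pos[of t] t by auto
    show ?thesis
      unfolding v_def p[symmetric] using N t by (intro jacobi_has_real_derivative) auto
  qed
  obtain b1 b2 where b: "q1 1 = (0, -2*b1)" "q2 1 = (-b2, b1)" "q3 1 = (b2, b1)"
    using adm unfolding admissible_def in_Q_E1_def by blast
  have end1: "z 1 0 = b2" "z 1 1 = - 3 * b1" "z 1 2 = 3/2 * b2" "z 1 3 = 3/2 * b1"
    unfolding z Z1_def Z2_def b by simp_all
  interpret minimizing_solution q1 q2 q3 z v "\<lambda>t. attraction1 (z t)" "\<lambda>t. attraction2 (z t)" "\<lambda>t. coupling (z t)"
  proof
    show "minimizer q1 q2 q3" by (rule min)
    show "action q1 q2 q3 = (\<integral>\<^sup>+t\<in>{0<..<1}. ennreal (lagrangian (z t) (v t)) \<partial>lborel)"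
    proof (rule action_eq[of "{}"])
      fix t :: real assume t: "t \<in> {0<..<1} - {}"
      have "(q1 has_vector_derivative v1 t) (at t) \<and> (q2 has_vector_derivative v2 t) (at t) \<and>
        (q3 has_vector_derivative v3 t) (at t)" using N t by blast
      then show "(q1 has_vector_derivative body1 (v t)) (at t) \<and>
        (q2 has_vector_derivative body2 (v t)) (at t) \<and> (q3 has_vector_derivative body3 (v t)) (at t)"
        using speed[of t] t by simp
    qed (use pos cf in auto)
    show "continuous_on {0..1} (\<lambda>t. z t i)" for i by (rule cont)
    show "((\<lambda>t. z t i) has_real_derivative v t i) (at t)" if "t \<in> {0<..<1}" for t i
      unfolding z_def v_def using N that by (intro jacobi_has_real_derivative) auto
    show "collision_free (z t)" if "t \<in> {0<..1}" for t by (rule cf[OF that])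
    show "z 0 0 = 0" "z 0 1 = 0" "z 0 2 > 0" "z 0 3 = 0"
      unfolding z using Z1_0 Z2_0 by (auto simp: pos_x_axis_def)
    show "z 1 2 = 3/2 * z 1 0" "z 1 3 = - z 1 1 / 2" unfolding end1 by simp_all
    show "z 1 0 \<ge> 0" "z 1 1 \<ge> 0" unfolding z using Z1_1 by (auto simp: closure_quadrant1)
    have c: "continuous_on {0<..<1} (\<lambda>t. z t i)" for i by (rule continuous_on_subset[OF cont]) auto
    show "continuous_on {0<..<1} (\<lambda>t. attraction1 (z t))" "continuous_on {0<..<1} (\<lambda>t. attraction2 (z t))"
      "continuous_on {0<..<1} (\<lambda>t. coupling (z t))"
      by (rule continuous_on_coefficients; use c cf in simp)+
    fix t :: real assume t: "t \<in> {0<..<1}"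
    then have cft: "collision_free (z t)" using cf by simp
    show "coupling (z t) > 0" by (rule coupling_pos[OF cft])
    note A = jacobi_force[OF cft]
    show "((\<lambda>t. v t 0) has_real_derivative
        coupling (z t) * (z t 0 * z t 2 + z t 1 * z t 3) * z t 2 - attraction1 (z t) * z t 0) (at t)"
      using acc[OF t, of 0] unfolding A .
    show "((\<lambda>t. v t 1) has_real_derivative
        coupling (z t) * (z t 0 * z t 2 + z t 1 * z t 3) * z t 3 - attraction1 (z t) * z t 1) (at t)"
      using acc[OF t, of 1] unfolding A .
    show "((\<lambda>t. v t 2) has_real_derivative
        3/4 * coupling (z t) * (z t 0 * z t 2 + z t 1 * z t 3) * z t 0 - attraction2 (z t) * z t 2) (at t)"
      using acc[OF t, of 2] unfolding A .
    show "((\<lambda>t. v t 3) has_real_derivative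
        3/4 * coupling (z t) * (z t 0 * z t 2 + z t 1 * z t 3) * z t 1 - attraction2 (z t) * z t 3) (at t)"
      using acc[OF t, of 3] unfolding A .
  qed
  show ?thesis
  proof (intro conjI impI)
    assume "Z1 1 \<in> quadrant1 \<or> Z2 1 \<in> quadrant4"
    \<comment> \<open>The end condition ties Z_2(1) to Z_1(1), so either alternative says that b2 >
      0 and b1 < 0.\<close>
    then have "z 1 0 > 0" "z 1 1 > 0"
      using end1 unfolding z by (auto simp: quadrant1_def quadrant4_def)
    then show "\<forall>t\<in>{0..1}. Z1 t \<in> closure quadrant1 \<and> Z2 t \<in> closure quadrant4"
      using quadrants(1,3) unfolding z closure_quadrant1 closure_quadrant4 by auto
  next
    assume "Z1 1 \<in> pos_x_axis \<and> Z2 1 \<in> pos_x_axis"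
    then have "z 1 0 > 0" unfolding z by (auto simp: pos_x_axis_def)
    then show "(\<forall>t\<in>{0..1}. Z1 t \<in> closure quadrant1 \<and> Z2 t \<in> closure quadrant4) \<or>
        (\<forall>t\<in>{0..1}. Z1 t \<in> closure quadrant4 \<and> Z2 t \<in> closure quadrant1)"
      using quadrants(1,2) unfolding z closure_quadrant1 closure_quadrant4 by auto
  qed
qed

end
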